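(* For each pair $(m,d)$ of natural numbers, choose any empirical-risk-minimizing learning algorithm $L_{m,d;\mathsf{ERM}}$ (of the form described in the context). Then $$\frac{c_\infty}{\sqrt{m/d}}\sim\inf_{L\in\mathcal L_{\mathsf{rand}}}\sup_D\mathfrak R_m(L,D)\le\inf_{L\in\mathcal L}\sup_D\mathfrak R_m(L,D)\le\sup_D\mathfrak R_m(L_{m,d;\mathsf{ERM}},D)\sim\frac{c_\infty}{\sqrt{m/d}}$$ whenever $m$ and $d$ vary so that $m/d\to\infty$, where $c_\infty:=\max_{z>0}\frac z2\big(1-\operatorname{erf}(z/\sqrt2)\big)=0.16997\dots$ and $\sup_D$ is over all probability distributions $D$ on $[d]\times\{-1,1\}$. Moreover, $$0\le\sup_D\mathfrak R_m(L_{m,d;\mathsf{ERM}},D)-\inf_{L\in\mathcal L_{\mathsf{rand}}}\sup_D\mathfrak R_m(L,D)\le\frac12\,\sup_{p,\beta}\ \sum_{x=1}^dp_x|\beta_x|\,\mathsf P\big(V^{p,\beta}_x=0\big)=O\Big(\frac1{m/d}\Big)=o\Big(\frac1{\sqrt{m/d}}\Big),$$ again whenever $m/d\to\infty$, where $\sup_{p,\beta}$ is over all $p\in[0,1]^{[d]}$ with $\sum_{x=1}^dp_x=1$ and all $\beta\in[-1,1]^{[d]}$, and $$V^{p,\beta}_x:=\sum_{i=1}^mY^{p,\beta}_i\operatorname{I}\{X^p_i=x\}.$$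
   Context: Setting: $\mathcal X=[d]=\{1,\dots,d\}$, $\mathcal Y=\{-1,1\}$, $\mathcal H=\mathcal Y^{\mathcal X}$. For a probability distribution $D$ on $\mathcal X\times\mathcal Y$, $(X^D,Y^D)$ is a random pair with distribution $D$, and $Z_m^D$ is the sequence of $m$ independent copies $(X_i^D,Y_i^D)$ of it. Put $\operatorname{err}(h,D)=\mathsf P(h(X^D)\ne Y^D)$ and $\Delta(h,D)=\operatorname{err}(h,D)-\min_{g\in\mathcal H}\operatorname{err}(g,D)$. $\mathcal L$ is the set of all (non-randomized) learning algorithms, i.e. maps $L\colon(\mathcal X\times\mathcal Y)^m\to\mathcal H$; $\mathcal L_{\mathsf{rand}}$ is the set of all randomized learning algorithms, i.e. maps $L\colon(\mathcal X\times\mathcal Y)^m\times[-1,1]\to\mathcal H$ (measurable in the last argument). The expected excess risk is $\mathfrak R_m(L,D):=\mathsf E\,\Delta(L(Z_m^D),D)$ for $L\in\mathcal L$ and $\mathfrak R_m(L,D):=\mathsf E\,\Delta(L(Z_m^D,U),D)$ for $L\in\mathcal L_{\mathsf{rand}}$, with $U$ uniform on $[-1,1]$ and independent of $Z_m^D$. For $z_m=((x_1,y_1),\dots,(x_m,y_m))$ let $v_x:=\sum_{i=1}^my_i\operatorname{I}\{x_i=x\}$ ($\operatorname{I}$ is the indicator). An empirical-risk-minimizing algorithm $L_{m,d;\mathsf{ERM}}$ is any $L\in\mathcal L$ such that for all $z_m\in(\mathcal X\times\mathcal Y)^m$ and $x\in[d]$: $L(z_m)(x)=1$ if $v_x>0$,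 $L(z_m)(x)=-1$ if $v_x<0$, and $L(z_m)(x)\in\{-1,1\}$ is arbitrary if $v_x=0$. For $p,\beta$ as in the claim, $(X^p_1,Y^{p,\beta}_1),\dots,(X^p_m,Y^{p,\beta}_m)$ are independent copies of a random pair with distribution $D_{p,\beta}$ given by $D_{p,\beta}(\{(x,y)\})=p_x\big(\frac12+\frac{y\beta_x}2\big)$. $\operatorname{erf}(u)=\frac2{\sqrt\pi}\int_0^ue^{-t^2}dt$. $A\sim B$ means $A/B\to1$. All limit relations are along arbitrary sequences of pairs $(m,d)$ of natural numbers with $m/d\to\infty$. *)

theory Defs
  imports "HOL-Probability.Probability" "HOL-Library.Landau_Symbols"
begin

definition erf :: "real \<Rightarrow> real" where
  "erf u = 2 / sqrt pi * (LBINT t=0..u. exp (- (t ^ 2)))"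

definition c_infty_fun :: "real \<Rightarrow> real" where
  "c_infty_fun z = z / 2 * (1 - erf (z / sqrt 2))"

text \<open>The operator \<open>GREATEST\<close> is a description; the main theorem states separately that
  the maximum is attained.\<close>

definition c_infty :: real where
  "c_infty = (GREATEST c. c \<in> c_infty_fun ` {0<..})"

definition examples :: "nat \<Rightarrow> (nat \<times> int) set" where
  "examples d = {1..d} \<times> {-1, 1}"

definition hypotheses :: "nat \<Rightarrow> (nat \<Rightarrow> int) set" where
  "hypotheses d = ({1..d} \<rightarrow>\<^sub>E {-1, 1})"

definition distributions :: "nat \<Rightarrow> (nat \<times> int) measure set" where
  "distributions d = {D. prob_space D \<and> sets D = Pow (examples d)}"

definition err :: "(nat \<Rightarrow> int) \<Rightarrow> (nat \<times> int) measure \<Rightarrow> real" where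
  "err h D = measure D {(x, y) \<in> space D. h x \<noteq> y}"

definition excess :: "nat \<Rightarrow> (nat \<Rightarrow> int) \<Rightarrow> (nat \<times> int) measure \<Rightarrow> real" where
  "excess d h D = err h D - (MIN g\<in>hypotheses d. err g D)"

type_synonym sample = "nat \<Rightarrow> nat \<times> int"

definition samples :: "nat \<Rightarrow> nat \<Rightarrow> sample set" where
  "samples m d = ({1..m} \<rightarrow>\<^sub>E examples d)"

text \<open>The joint law of \<open>m\<close> independent copies; its space is \<open>samples m d\<close> whenever
  \<open>D \<in> distributions d\<close>.\<close>

definition sample_law :: "nat \<Rightarrow> (nat \<times> int) measure \<Rightarrow> sample measure" where
  "sample_law m D = (\<Pi>\<^sub>M i\<in>{1..m}. D)"

text \<open>A probability measure whose space is the interval itself, so that randomized algorithms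
  need to be defined and measurable only there.\<close>

definition uniform_law :: "real measure" where
  "uniform_law = uniform_measure (restrict_space lborel {-1..1}) {-1..1}"

definition learners :: "nat \<Rightarrow> nat \<Rightarrow> (sample \<Rightarrow> nat \<Rightarrow> int) set" where
  "learners m d = (samples m d \<rightarrow> hypotheses d)"

definition rand_learners :: "nat \<Rightarrow> nat \<Rightarrow> (sample \<Rightarrow> real \<Rightarrow> nat \<Rightarrow> int) set" where
  "rand_learners m d =
     (samples m d \<rightarrow> (restrict_space borel {-1..1} \<rightarrow>\<^sub>M count_space (hypotheses d)))"

definition risk ::
  "nat \<Rightarrow> nat \<Rightarrow> (sample \<Rightarrow> nat \<Rightarrow> int) \<Rightarrow> (nat \<times> int) measure \<Rightarrow> real" where
  "risk m d L D = (\<integral>z. excess d (L z) D \<partial>sample_law m D)"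

text \<open>The product measure expresses the independence of the sample and the randomization.\<close>

definition rand_risk ::
  "nat \<Rightarrow> nat \<Rightarrow> (sample \<Rightarrow> real \<Rightarrow> nat \<Rightarrow> int) \<Rightarrow> (nat \<times> int) measure \<Rightarrow> real" where
  "rand_risk m d L D =
     (\<integral>(z, u). excess d (L z u) D \<partial>(sample_law m D \<Otimes>\<^sub>M uniform_law))"

text \<open>All risks lie in \<open>[0, 1]\<close>, and for \<open>d \<ge> 1\<close> all index sets below are nonempty, so the real
  suprema and infima are the genuine ones.\<close>

definition worst_risk :: "nat \<Rightarrow> nat \<Rightarrow> (sample \<Rightarrow> nat \<Rightarrow> int) \<Rightarrow> real" where
  "worst_risk m d L = (SUP D\<in>distributions d. risk m d L D)"

definition minimax_risk :: "nat \<Rightarrow> nat \<Rightarrow> real" where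
  "minimax_risk m d = (INF L\<in>learners m d. SUP D\<in>distributions d. risk m d L D)"

definition minimax_rand_risk :: "nat \<Rightarrow> nat \<Rightarrow> real" where
  "minimax_rand_risk m d = (INF L\<in>rand_learners m d. SUP D\<in>distributions d. rand_risk m d L D)"

definition vote :: "nat \<Rightarrow> sample \<Rightarrow> nat \<Rightarrow> int" where
  "vote m z x = (\<Sum>i=1..m. snd (z i) * of_bool (fst (z i) = x))"

definition is_ERM :: "nat \<Rightarrow> nat \<Rightarrow> (sample \<Rightarrow> nat \<Rightarrow> int) \<Rightarrow> bool" where
  "is_ERM m d L \<longleftrightarrow> L \<in> learners m d \<and>
     (\<forall>z\<in>samples m d. \<forall>x\<in>{1..d}.
        (vote m z x > 0 \<longrightarrow> L z x = 1) \<and> (vote m z x < 0 \<longrightarrow> L z x = -1))"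

definition param_dist :: "nat \<Rightarrow> (nat \<Rightarrow> real) \<Rightarrow> (nat \<Rightarrow> real) \<Rightarrow> (nat \<times> int) measure" where
  "param_dist d p \<beta> =
     point_measure (examples d) (\<lambda>(x, y). ennreal (p x * (1 / 2 + real_of_int y * \<beta> x / 2)))"

definition tie_prob :: "nat \<Rightarrow> nat \<Rightarrow> (nat \<Rightarrow> real) \<Rightarrow> (nat \<Rightarrow> real) \<Rightarrow> nat \<Rightarrow> real" where
  "tie_prob m d p \<beta> x =
     measure (sample_law m (param_dist d p \<beta>))
       {z \<in> space (sample_law m (param_dist d p \<beta>)). vote m z x = 0}"

definition params :: "nat \<Rightarrow> ((nat \<Rightarrow> real) \<times> (nat \<Rightarrow> real)) set" where
  "params d = {(p, \<beta>). p \<in> {1..d} \<rightarrow> {0..1} \<and> (\<Sum>x=1..d. p x) = 1 \<and> \<beta> \<in> {1..d} \<rightarrow> {-1..1}}"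

definition tie_bound :: "nat \<Rightarrow> nat \<Rightarrow> real" where
  "tie_bound m d =
     1 / 2 * (SUP (p, \<beta>)\<in>params d. \<Sum>x=1..d. p x * \<bar>\<beta> x\<bar> * tie_prob m d p \<beta> x)"

end

theory Submission
  imports Defs "HOL-Computational_Algebra.Polynomial" "HOL-Real_Asymp.Real_Asymp"
begin

text \<open>
  Lower bound: fix \<open>p\<close> and \<open>\<bar>\<beta>\<bar>\<close> and choose the signs of \<open>\<beta>\<close> uniformly at random. Given the
  sample, the posterior odds of the sign at \<open>x\<close> are \<open>((1 + \<bar>\<beta>\<bar>) / (1 - \<bar>\<beta>\<bar>)) ^ v\<close> with \<open>v\<close> the vote
  at \<open>x\<close>, so majority voting with fair tie breaking is the Bayes rule, and by symmetry its risk
  does not depend on the signs. An arbitrary empirical risk minimizer loses against it at most half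
  of the tie probability at each point. In the binomial expansion of the tie probability the bound
  \<open>\<bar>\<beta>\<bar> * (2 * k choose k) * ((1 - \<beta>\<^sup>2) / 4) ^ k \<le> 1 / (2 * k + 1)\<close> turns the sum into an incomplete
  binomial sum of order \<open>m + 1\<close>.

  Asymptotics: with \<open>\<beta>\<^sub>x = z / sqrt (m * p\<^sub>x)\<close> and \<open>m * p\<^sub>x\<close> tending to infinity, the probability of a
  wrong vote tends to the normal tail at \<open>z\<close>, and \<open>z\<close> times this tail is at most \<open>c_infty\<close>. The
  convergence is uniform by a compactness argument: large \<open>z\<close> is excluded by a Chernoff bound, and
  points with \<open>m * p\<^sub>x\<close> bounded contribute \<open>O(d / m)\<close> altogether. The worst case over \<open>p\<close> is the
  uniform distribution because the sum of the \<open>sqrt p\<^sub>x\<close> is at most \<open>sqrt d\<close>.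
\<close>

section \<open>Distributions, samples and risks as finite sums\<close>

text \<open>Every distribution on the examples is some \<open>param_dist d p b\<close>, and the
  sample spaces are finite, so each risk is a finite weighted sum in which the points x decouple: a
  wrong label at x costs \<open>p x * \<bar>b x\<bar>\<close>. With \<zeta> = |b x| sqrt(m p x) the
  contribution of x is sqrt(p x / m) times \<zeta> times the probability of a wrong vote. This is
  the origin of the product of z with a normal tail, and of the sum of the square roots of
  \<open>p x\<close>. The lower bound for randomized learners and the upper bound for an empirical
  risk minimizer are the same sum, except that a tie weighs 1/2 in the former and 1 in the latter.
  The gap is therefore controlled before any limit theorem is used. Two obstacles shape the rest.
  The tie probability alone can be of order (m p x)^(-1/2), which is too large; its weight |b x| has
  to be exploited to gain the missing square root. And the normal approximation is needed uniformly
  over p and b, which may vary with m and d, while some points may receive few observations.\<close>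

definition wt :: "(nat \<Rightarrow> real) \<Rightarrow> (nat \<Rightarrow> real) \<Rightarrow> nat \<times> int \<Rightarrow> real" where
  "wt p b = (\<lambda>(x, y). p x * (1 / 2 + real_of_int y * b x / 2))"

definition sample_wt :: "nat \<Rightarrow> (nat \<Rightarrow> real) \<Rightarrow> (nat \<Rightarrow> real) \<Rightarrow> sample \<Rightarrow> real" where
  "sample_wt m p b z = (\<Prod>i\<in>{1..m}. wt p b (z i))"

text \<open>The codomain is any real vector space so that one operator serves both probabilities and
  complex characteristic functions. Being a finite sum, it is linear without integrability
  conditions.\<close>

definition expect :: "nat \<Rightarrow> nat \<Rightarrow> (nat \<Rightarrow> real) \<Rightarrow> (nat \<Rightarrow> real) \<Rightarrow> (sample \<Rightarrow> 'a) \<Rightarrow> 'a::real_vector" where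
  "expect m d p b f = (\<Sum>z\<in>samples m d. sample_wt m p b z *\<^sub>R f z)"

lemma finite_examples [simp, intro]: "finite (examples d)"
  by (simp add: examples_def)

lemma finite_samples [simp, intro]: "finite (samples m d)"
  by (simp add: samples_def finite_PiE)

lemma finite_hypotheses [simp, intro]: "finite (hypotheses d)"
  by (simp add: hypotheses_def finite_PiE)

lemma hypotheses_nonempty: "hypotheses d \<noteq> {}"
  by (auto simp: hypotheses_def PiE_eq_empty_iff)

lemma sum_examples:
  "(\<Sum>e\<in>examples d. f e) = (\<Sum>x=1..d. f (x, 1) + f (x, -1))" for f :: "_ \<Rightarrow> 'a::comm_monoid_add"
proof -
  have "sum f (examples d) = (\<Sum>x=1..d. \<Sum>y\<in>{-1, 1}. f (x, y))"
    unfolding examples_def by (simp only: sum.cartesian_product case_prod_eta)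
  then show ?thesis by (simp add: add.commute)
qed

lemma sum_examples_split:
  fixes f :: "_ \<Rightarrow> 'a::comm_monoid_add"
  assumes "x \<in> {1..d}"
  shows "(\<Sum>e\<in>examples d. f e) = (f (x, 1) + f (x, -1)) + (\<Sum>y\<in>{1..d} - {x}. f (y, 1) + f (y, -1))"
  unfolding sum_examples by (rule sum.remove) (use assms in auto)

lemma params_D:
  assumes "(p, b) \<in> params d"
  shows "\<And>x. x \<in> {1..d} \<Longrightarrow> 0 \<le> p x" "\<And>x. x \<in> {1..d} \<Longrightarrow> p x \<le> 1"
    "\<And>x. x \<in> {1..d} \<Longrightarrow> \<bar>b x\<bar> \<le> 1" "(\<Sum>x=1..d. p x) = 1"
proof -
  have "\<And>x. x \<in> {1..d} \<Longrightarrow> p x \<in> {0..1}" "\<And>x. x \<in> {1..d} \<Longrightarrow> b x \<in> {-1..1}"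
    using assms by (auto simp: params_def Pi_iff)
  then show "\<And>x. x \<in> {1..d} \<Longrightarrow> 0 \<le> p x" "\<And>x. x \<in> {1..d} \<Longrightarrow> p x \<le> 1"
    "\<And>x. x \<in> {1..d} \<Longrightarrow> \<bar>b x\<bar> \<le> 1" by (force simp: abs_le_iff)+
  show "(\<Sum>x=1..d. p x) = 1" using assms by (simp add: params_def)
qed

text \<open>The constraints on the biases see only absolute values, which is what allows the signs
  to be randomized and later removed.\<close>

lemma params_sign:
  assumes "(p, b) \<in> params d" "\<And>x. x \<in> {1..d} \<Longrightarrow> \<bar>b' x\<bar> = \<bar>b x\<bar>"
  shows "(p, b') \<in> params d"
proof -
  have "b' \<in> {1..d} \<rightarrow> {-1..1}"
    using params_D(3)[OF assms(1)] assms(2) by (fastforce simp: abs_le_iff)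
  with assms(1) show ?thesis by (simp add: params_def)
qed

lemma wt_nonneg:
  assumes "(p, b) \<in> params d" "e \<in> examples d"
  shows "0 \<le> wt p b e"
proof -
  from assms(2) obtain x y where e: "e = (x, y)" "x \<in> {1..d}" "y = 1 \<or> y = -1"
    by (auto simp: examples_def)
  have "0 \<le> p x" "\<bar>b x\<bar> \<le> 1" using params_D[OF assms(1)] e(2) by auto
  then show ?thesis using e by (auto simp: wt_def)
qed

lemma sum_wt:
  assumes "(p, b) \<in> params d"
  shows "(\<Sum>e\<in>examples d. wt p b e) = 1"
  unfolding sum_examples using params_D(4)[OF assms] by (simp add: wt_def field_simps)

lemma param_dist_eq: "param_dist d p b = point_measure (examples d) (\<lambda>e. ennreal (wt p b e))"
  unfolding param_dist_def wt_def by (rule arg_cong2[where f=point_measure]) auto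

lemma prob_space_param_dist:
  assumes "(p, b) \<in> params d"
  shows "prob_space (param_dist d p b)"
  unfolding param_dist_eq
  by (rule prob_space_point_measure)
     (use wt_nonneg[OF assms] sum_wt[OF assms] in \<open>auto simp: sum_ennreal\<close>)

lemma measure_param_dist:
  assumes "(p, b) \<in> params d" "A \<subseteq> examples d"
  shows "measure (param_dist d p b) A = (\<Sum>e\<in>A. wt p b e)"
  unfolding param_dist_eq
  using wt_nonneg[OF assms(1)] assms(2) by (subst measure_point_measure_finite_if) auto

lemma param_dist_in_distributions:
  "(p, b) \<in> params d \<Longrightarrow> param_dist d p b \<in> distributions d"
  using prob_space_param_dist[of p b d]
  by (auto simp: distributions_def param_dist_eq sets_point_measure)

text \<open>Disintegration into the marginal p of the point and the conditional mean b of the label.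
  It turns a supremum over distributions into one over pairs (p, b).\<close>

lemma distributions_cases:
  assumes "D \<in> distributions d"
  obtains p b where "(p, b) \<in> params d" "D = param_dist d p b"
proof -
  interpret prob_space D using assms by (simp add: distributions_def)
  have sD: "sets D = Pow (examples d)" using assms by (simp add: distributions_def)
  then have spD: "space D = examples d" by (metis Pow_top sets.sets_into_space sets.top subset_antisym Pow_iff)
  define P where "P x = prob {(x, 1)} + prob {(x, -1)}" for x :: nat
  \<comment> \<open>Where \<open>P x = 0\<close> the quotient is 0 by convention; both masses vanish
    there, so \<open>P x * B x\<close> is still their difference.\<close>
  define B where "B x = (prob {(x, 1)} - prob {(x, -1)}) / P x" for x :: nat
  have sum1: "(\<Sum>e\<in>A. prob {e}) = prob A" if "A \<subseteq> examples d" for A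
    by (rule finite_measure_eq_sum_singleton[symmetric])
       (use that sD finite_subset[OF that] in auto)
  have P0: "0 \<le> P x" for x by (simp add: P_def)
  have sumP: "(\<Sum>x=1..d. P x) = 1"
    using sum1[of "examples d"] prob_space by (simp add: sum_examples P_def spD)
  have P1: "P x \<le> 1" if "x \<in> {1..d}" for x
    using member_le_sum[of x "{1..d}" P] P0 that sumP by simp
  have B1: "\<bar>B x\<bar> \<le> 1" for x
  proof -
    have "\<bar>prob {(x, 1)} - prob {(x, -1)}\<bar> \<le> P x"
      using measure_nonneg[of D "{(x, 1)}"] measure_nonneg[of D "{(x, -1)}"] unfolding P_def by linarith
    then show ?thesis using P0[of x] by (cases "P x = 0") (auto simp: B_def abs_divide)
  qed
  have par: "(P, B) \<in> params d"
    using P0 P1 sumP B1 by (simp add: params_def Pi_iff abs_le_iff minus_le_iff)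
  have wt: "wt P B e = prob {e}" if "e \<in> examples d" for e
  proof -
    from that obtain x y where e: "e = (x, y)" "x \<in> {1..d}" "y = 1 \<or> y = -1"
      by (auto simp: examples_def)
    have "P x = 0 \<longrightarrow> prob {(x, 1)} = 0 \<and> prob {(x, -1)} = 0"
      using measure_nonneg[of D "{(x, 1)}"] measure_nonneg[of D "{(x, -1)}"] unfolding P_def by linarith
    moreover have "P x * B x = prob {(x, 1)} - prob {(x, -1)}"
      using calculation by (auto simp: B_def)
    ultimately show ?thesis using e by (auto simp: wt_def P_def algebra_simps)
  qed
  have "D = param_dist d P B"
  proof (rule measure_eqI_finite[of _ "examples d"])
    fix e assume e: "e \<in> examples d"
    then show "emeasure D {e} = emeasure (param_dist d P B) {e}"
      unfolding param_dist_eq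
      by (subst emeasure_point_measure_finite) (auto simp: wt emeasure_eq_measure)
  qed (auto simp: sD param_dist_eq sets_point_measure)
  with par that show ?thesis by blast
qed

lemma sample_wt_nonneg:
  assumes "(p, b) \<in> params d" "z \<in> samples m d"
  shows "0 \<le> sample_wt m p b z"
  unfolding sample_wt_def
  by (rule prod_nonneg) (use assms in \<open>auto simp: samples_def intro!: wt_nonneg\<close>)

text \<open>Independence enters through this distributive law. It is applied to real weights, to
  complex exponentials and to polynomials, hence the general semiring.\<close>

lemma sum_sample_prod:
  fixes f :: "nat \<times> int \<Rightarrow> 'a::comm_semiring_1"
  shows "(\<Sum>z\<in>samples m d. \<Prod>i\<in>{1..m}. f (z i)) = (\<Sum>e\<in>examples d. f e) ^ m"
  unfolding samples_def using prod_sum_PiE[of "{1..m}" "\<lambda>_. examples d" "\<lambda>_. f"] by simp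

lemma sum_sample_wt:
  assumes "(p, b) \<in> params d"
  shows "(\<Sum>z\<in>samples m d. sample_wt m p b z) = 1"
  unfolding sample_wt_def sum_sample_prod sum_wt[OF assms] by simp

text \<open>A singleton of samples is a finite box, so it is measurable; as there are finitely many
  samples, every subset is. Both measures are then determined by their atoms, where the product law
  is a product of weights.\<close>

lemma sample_law_eq:
  assumes "(p, b) \<in> params d"
  shows "sample_law m (param_dist d p b) = point_measure (samples m d) (\<lambda>z. ennreal (sample_wt m p b z))"
proof -
  interpret prob_space "param_dist d p b" by (rule prob_space_param_dist[OF assms])
  interpret product_prob_space "\<lambda>_. param_dist d p b" "{1..m}" ..
  interpret finite_product_sigma_finite "\<lambda>_. param_dist d p b" "{1..m}" by standard auto
  have sets_D: "sets (param_dist d p b) = Pow (examples d)"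
    and space_D: "space (param_dist d p b) = examples d"
    by (simp_all add: param_dist_eq sets_point_measure space_point_measure)
  have space: "space (sample_law m (param_dist d p b)) = samples m d"
    by (simp add: sample_law_def space_PiM samples_def space_D)
  have single: "{z} = (\<Pi>\<^sub>E i\<in>{1..m}. {z i})" if "z \<in> samples m d" for z
    using PiE_singleton[of z "{1..m}"] that by (simp add: samples_def PiE_iff)
  have single_sets: "{z} \<in> sets (sample_law m (param_dist d p b))" if z: "z \<in> samples m d" for z
    unfolding single[OF z] sample_law_def
    by (rule sets_PiM_I_finite) (use z in \<open>auto simp: sets_D samples_def\<close>)
  have sets: "sets (sample_law m (param_dist d p b)) = Pow (samples m d)"
  proof (intro equalityI subsetI)
    fix A assume "A \<in> sets (sample_law m (param_dist d p b))"
    then show "A \<in> Pow (samples m d)" using sets.sets_into_space space by blast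
  next
    fix A assume A: "A \<in> Pow (samples m d)"
    then have "countable A" by (meson Pow_iff countable_finite finite_samples finite_subset)
    moreover have "(\<Union>z\<in>A. {z}) \<in> sets (sample_law m (param_dist d p b))"
      using A single_sets by (intro sets.countable_UN') (auto intro: calculation)
    ultimately show "A \<in> sets (sample_law m (param_dist d p b))" by simp
  qed
  show ?thesis
  proof (rule measure_eqI_finite[of _ "samples m d"])
    fix z assume z: "z \<in> samples m d"
    have zi: "z i \<in> examples d" if "i \<in> {1..m}" for i using z that by (auto simp: samples_def)
    have "emeasure (sample_law m (param_dist d p b)) {z} = (\<Prod>i\<in>{1..m}. emeasure (param_dist d p b) {z i})"
      unfolding single[OF z] sample_law_def
      by (rule emeasure_PiM) (use zi in \<open>auto simp: sets_D\<close>)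
    also have "\<dots> = (\<Prod>i\<in>{1..m}. ennreal (wt p b (z i)))"
      unfolding param_dist_eq
      by (rule prod.cong) (use zi in \<open>auto simp: emeasure_point_measure_finite\<close>)
    also have "\<dots> = ennreal (sample_wt m p b z)"
      unfolding sample_wt_def by (rule prod_ennreal) (use zi wt_nonneg[OF assms] in auto)
    finally show "emeasure (sample_law m (param_dist d p b)) {z} =
        emeasure (point_measure (samples m d) (\<lambda>z. ennreal (sample_wt m p b z))) {z}"
      using z by (simp add: emeasure_point_measure_finite)
  qed (auto simp: sets sets_point_measure)
qed

lemma integral_sample_law:
  fixes f :: "sample \<Rightarrow> 'a::{banach, second_countable_topology}"
  assumes "(p, b) \<in> params d"
  shows "(\<integral>z. f z \<partial>sample_law m (param_dist d p b)) = expect m d p b f"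
  unfolding sample_law_eq[OF assms] expect_def
  by (rule lebesgue_integral_point_measure_finite) (use sample_wt_nonneg[OF assms] in auto)

lemma expect_cong: "(\<And>z. z \<in> samples m d \<Longrightarrow> f z = g z) \<Longrightarrow> expect m d p b f = expect m d p b g"
  unfolding expect_def by simp

lemma expect_mono:
  fixes f g :: "sample \<Rightarrow> real"
  assumes "(p, b) \<in> params d" "\<And>z. z \<in> samples m d \<Longrightarrow> f z \<le> g z"
  shows "expect m d p b f \<le> expect m d p b g"
  unfolding expect_def using assms sample_wt_nonneg[OF assms(1)] by (auto intro!: sum_mono mult_left_mono)

lemma expect_const: "(p, b) \<in> params d \<Longrightarrow> expect m d p b (\<lambda>_. c) = c"
  unfolding expect_def using sum_sample_wt by (simp add: scaleR_sum_left[symmetric])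

lemma expect_add: "expect m d p b (\<lambda>z. f z + g z) = expect m d p b f + expect m d p b g"
  unfolding expect_def by (simp add: scaleR_add_right sum.distrib)

lemma expect_cmult: "expect m d p b (\<lambda>z. c * f z) = c * expect m d p b f" for c :: real
  unfolding expect_def by (simp add: sum_distrib_left mult_ac)

lemma expect_sum: "expect m d p b (\<lambda>z. \<Sum>x\<in>A. f x z) = (\<Sum>x\<in>A. expect m d p b (f x))"
  unfolding expect_def by (subst sum.swap) (simp add: scaleR_sum_right)

lemma tie_prob_eq:
  assumes "(p, b) \<in> params d"
  shows "tie_prob m d p b x = expect m d p b (\<lambda>z. of_bool (vote m z x = 0))"
proof -
  have "tie_prob m d p b x = (\<Sum>z\<in>{z \<in> samples m d. vote m z x = 0}. sample_wt m p b z)"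
    unfolding tie_prob_def sample_law_eq[OF assms] space_point_measure
    using sample_wt_nonneg[OF assms]
    by (subst measure_point_measure_finite_if) auto
  also have "\<dots> = (\<Sum>z\<in>samples m d. if vote m z x = 0 then sample_wt m p b z else 0)"
    by (rule sum.inter_filter) simp
  also have "\<dots> = expect m d p b (\<lambda>z. of_bool (vote m z x = 0))"
    unfolding expect_def by (rule sum.cong) auto
  finally show ?thesis .
qed

lemma err_param_dist:
  assumes "(p, b) \<in> params d" "h \<in> hypotheses d"
  shows "err h (param_dist d p b) = (\<Sum>x=1..d. p x * (1 - real_of_int (h x) * b x) / 2)"
proof -
  have "err h (param_dist d p b) = (\<Sum>e\<in>{e \<in> examples d. h (fst e) \<noteq> snd e}. wt p b e)"
    unfolding err_def
    by (subst measure_param_dist[OF assms(1), symmetric])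
       (auto simp: param_dist_eq space_point_measure intro!: arg_cong2[where f = measure])
  also have "\<dots> = (\<Sum>e\<in>examples d. if h (fst e) \<noteq> snd e then wt p b e else 0)"
    by (rule sum.inter_filter) simp
  also have "\<dots> = (\<Sum>x=1..d. p x * (1 - real_of_int (h x) * b x) / 2)"
    unfolding sum_examples
  proof (rule sum.cong)
    fix x assume "x \<in> {1..d}"
    then have "h x = 1 \<or> h x = -1" using assms(2) by (auto simp: hypotheses_def)
    then show "(if h (fst (x, 1)) \<noteq> snd (x, 1) then wt p b (x, 1) else 0) +
      (if h (fst (x, - 1)) \<noteq> snd (x, - 1) then wt p b (x, - 1) else 0) =
      p x * (1 - real_of_int (h x) * b x) / 2"
      by (auto simp: wt_def field_simps)
  qed simp
  finally show ?thesis .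
qed

text \<open>The error separates over the points, so the minimum is found pointwise, by the sign of
  \<open>b x\<close>. A summand is 0 for this label and \<open>p x * \<bar>b x\<bar>\<close> for the
  opposite one.\<close>

lemma excess_param_dist:
  assumes "(p, b) \<in> params d" "h \<in> hypotheses d"
  shows "excess d h (param_dist d p b) = (\<Sum>x=1..d. p x * (\<bar>b x\<bar> - real_of_int (h x) * b x) / 2)"
proof -
  define g where "g = (\<lambda>x\<in>{1..d}. if b x \<ge> 0 then 1 else - 1 :: int)"
  have g: "g \<in> hypotheses d" by (auto simp: g_def hypotheses_def)
  have "(MIN g\<in>hypotheses d. err g (param_dist d p b)) = (\<Sum>x=1..d. p x * (1 - \<bar>b x\<bar>) / 2)"
  proof (rule Min_eqI)
    show "(\<Sum>x=1..d. p x * (1 - \<bar>b x\<bar>) / 2) \<in> (\<lambda>g. err g (param_dist d p b)) ` hypotheses d"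
    proof (rule image_eqI[OF _ g])
      show "(\<Sum>x=1..d. p x * (1 - \<bar>b x\<bar>) / 2) = err g (param_dist d p b)"
        unfolding err_param_dist[OF assms(1) g] by (rule sum.cong) (auto simp: g_def)
    qed
  next
    fix y assume "y \<in> (\<lambda>g. err g (param_dist d p b)) ` hypotheses d"
    then obtain f where f: "f \<in> hypotheses d" "y = err f (param_dist d p b)" by blast
    show "(\<Sum>x=1..d. p x * (1 - \<bar>b x\<bar>) / 2) \<le> y"
      unfolding f(2) err_param_dist[OF assms(1) f(1)]
    proof (rule sum_mono)
      fix x assume x: "x \<in> {1..d}"
      then have "f x = 1 \<or> f x = -1" using f(1) by (auto simp: hypotheses_def)
      then have "real_of_int (f x) * b x \<le> \<bar>b x\<bar>" by auto
      then show "p x * (1 - \<bar>b x\<bar>) / 2 \<le> p x * (1 - real_of_int (f x) * b x) / 2"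
        using params_D(1)[OF assms(1) x] by (intro divide_right_mono mult_left_mono) auto
    qed
  qed simp
  then show ?thesis
    unfolding excess_def err_param_dist[OF assms]
    by (simp only: sum_subtractf[symmetric], intro sum.cong) (auto simp: field_simps)
qed

lemma excess_bounds:
  assumes "D \<in> distributions d" "h \<in> hypotheses d"
  shows "0 \<le> excess d h D" "excess d h D \<le> 1"
proof -
  have *: "\<And>g. 0 \<le> err g D" "\<And>g. err g D \<le> 1"
    using assms(1) by (auto simp: err_def distributions_def prob_space.prob_le_1)
  have "(MIN g\<in>hypotheses d. err g D) \<in> (\<lambda>g. err g D) ` hypotheses d"
    by (rule Min_in) (auto simp: hypotheses_nonempty)
  with * have "0 \<le> (MIN g\<in>hypotheses d. err g D)" by auto
  then show "excess d h D \<le> 1" unfolding excess_def using *(2)[of h] by linarith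
  have "(MIN g\<in>hypotheses d. err g D) \<le> err h D" using assms(2) by (intro Min_le) auto
  then show "0 \<le> excess d h D" unfolding excess_def by simp
qed

section \<open>Randomized learners: the risk as an iterated expectation\<close>

lemma prob_space_uniform_law: "prob_space uniform_law"
  unfolding uniform_law_def
  by (rule prob_space_uniform_measure) (auto simp: emeasure_restrict_space sets_restrict_space)

lemma uniform_law_measurable_cong:
  "measurable uniform_law N = measurable (restrict_space borel {-1..1}) N"
  by (rule measurable_cong_sets) (simp_all add: uniform_law_def sets_restrict_space)

lemma rand_learner_in_hypotheses:
  assumes "L \<in> rand_learners m d" "z \<in> samples m d" "u \<in> space uniform_law"
  shows "L z u \<in> hypotheses d"
proof -
  have "L z \<in> uniform_law \<rightarrow>\<^sub>M count_space (hypotheses d)"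
    using assms by (auto simp: rand_learners_def uniform_law_measurable_cong)
  from measurable_space[OF this assms(3)] show ?thesis by simp
qed

text \<open>Fubini. Joint measurability comes for free from the first coordinate: it ranges over a
  finite set all of whose subsets are measurable, so measurability of each section in u
  suffices.\<close>

lemma rand_risk_eq:
  assumes "(p, b) \<in> params d" "L \<in> rand_learners m d"
  shows "rand_risk m d L (param_dist d p b)
    = expect m d p b (\<lambda>z. \<integral>u. excess d (L z u) (param_dist d p b) \<partial>uniform_law)"
proof -
  let ?D = "param_dist d p b" and ?S = "sample_law m (param_dist d p b)"
  interpret U: prob_space uniform_law by (rule prob_space_uniform_law)
  interpret D: prob_space ?D by (rule prob_space_param_dist[OF assms(1)])
  interpret S: prob_space ?S unfolding sample_law_def by (rule prob_space_PiM) (rule D.prob_space_axioms)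
  interpret pair_prob_space ?S uniform_law ..
  have D: "?D \<in> distributions d" by (rule param_dist_in_distributions[OF assms(1)])
  have sp: "space ?S = samples m d" by (simp add: sample_law_eq[OF assms(1)] space_point_measure)
  have Lz: "(\<lambda>u. excess d (L z u) ?D) \<in> borel_measurable uniform_law" if "z \<in> samples m d" for z
  proof -
    have "L z \<in> uniform_law \<rightarrow>\<^sub>M count_space (hypotheses d)"
      using assms that by (auto simp: rand_learners_def uniform_law_measurable_cong)
    from measurable_compose[OF this, of "\<lambda>h. excess d h ?D" borel] show ?thesis by simp
  qed
  have meas: "(\<lambda>(z, u). excess d (L z u) ?D) \<in> borel_measurable (?S \<Otimes>\<^sub>M uniform_law)"
  proof -
    have eq: "sets (?S \<Otimes>\<^sub>M uniform_law) = sets (count_space (samples m d) \<Otimes>\<^sub>M uniform_law)"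
      by (rule sets_pair_measure_cong) (auto simp: sample_law_eq[OF assms(1)] sets_point_measure)
    have "(\<lambda>(z, u). excess d (L z u) ?D) \<in> borel_measurable (count_space (samples m d) \<Otimes>\<^sub>M uniform_law)"
      by (rule measurable_pair_measure_countable1) (auto intro!: countable_finite Lz)
    then show ?thesis by (simp add: measurable_cong_sets[OF eq refl])
  qed
  have "integrable (?S \<Otimes>\<^sub>M uniform_law) (\<lambda>(z, u). excess d (L z u) ?D)"
  proof (rule finite_measure.integrable_const_bound[of _ _ 1])
    show "finite_measure (?S \<Otimes>\<^sub>M uniform_law)" by (rule finite_measure_axioms)
    show "AE x in ?S \<Otimes>\<^sub>M uniform_law. norm (case x of (z, u) \<Rightarrow> excess d (L z u) ?D) \<le> 1"
      by (rule AE_I2)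
         (use excess_bounds[OF D rand_learner_in_hypotheses[OF assms(2)]] in
           \<open>auto simp: space_pair_measure sp\<close>)
  qed (rule meas)
  from integral_fst'[OF this]
  show ?thesis unfolding rand_risk_def integral_sample_law[OF assms(1), symmetric] by simp
qed

lemma risk_eq:
  "(p, b) \<in> params d \<Longrightarrow> risk m d L (param_dist d p b) = expect m d p b (\<lambda>z. excess d (L z) (param_dist d p b))"
  unfolding risk_def by (rule integral_sample_law)

section \<open>Majority voting is the Bayes rule\<close>

text \<open>For a sign vector \<open>s\<close> this involution of the samples carries the law with
  biases \<open>b x\<close> to the law with biases \<open>s x * b x\<close>, and it multiplies the
  vote at x by \<open>s x\<close>. Sign vectors are taken from \<open>hypotheses d\<close>.\<close>

definition flip :: "nat \<Rightarrow> (nat \<Rightarrow> int) \<Rightarrow> sample \<Rightarrow> sample" where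
  "flip m s z = (\<lambda>i\<in>{1..m}. (fst (z i), snd (z i) * s (fst (z i))))"

lemma sampleD:
  assumes "z \<in> samples m d" "i \<in> {1..m}"
  shows "fst (z i) \<in> {1..d}" "snd (z i) = 1 \<or> snd (z i) = -1"
proof -
  have "z i \<in> examples d" using assms by (auto simp: samples_def)
  then show "fst (z i) \<in> {1..d}" "snd (z i) = 1 \<or> snd (z i) = -1" by (auto simp: examples_def)
qed

lemma hypothesis_cases:
  assumes "s \<in> hypotheses d" "x \<in> {1..d}"
  obtains "s x = 1" | "s x = -1"
  using assms that by (auto simp: hypotheses_def PiE_def Pi_def)

lemma flip_in_samples:
  assumes "s \<in> hypotheses d" "z \<in> samples m d"
  shows "flip m s z \<in> samples m d"
proof -
  have "(fst (z i), snd (z i) * s (fst (z i))) \<in> examples d" if i: "i \<in> {1..m}" for i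
    using sampleD[OF assms(2) i] by (cases rule: hypothesis_cases[OF assms(1)]) (auto simp: examples_def)
  then show ?thesis by (auto simp: samples_def flip_def)
qed

lemma flip_flip:
  assumes "s \<in> hypotheses d" "z \<in> samples m d"
  shows "flip m s (flip m s z) = z"
proof
  fix i
  show "flip m s (flip m s z) i = z i"
  proof (cases "i \<in> {1..m}")
    case True
    from sampleD(1)[OF assms(2) this] show ?thesis
      by (cases rule: hypothesis_cases[OF assms(1)]) (use True in \<open>auto simp: flip_def prod_eq_iff\<close>)
  next
    case False
    then show ?thesis using assms(2) by (auto simp: flip_def samples_def PiE_def extensional_def)
  qed
qed

lemma vote_flip: "vote m (flip m s z) x = s x * vote m z x"
  unfolding vote_def sum_distrib_left by (rule sum.cong) (auto simp: flip_def)

lemma sample_wt_flip: "sample_wt m p b (flip m s z) = sample_wt m p (\<lambda>x. real_of_int (s x) * b x) z"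
  unfolding sample_wt_def
  by (rule prod.cong) (auto simp: flip_def wt_def split: prod.splits)

lemma expect_flip:
  assumes "s \<in> hypotheses d"
  shows "expect m d p (\<lambda>x. real_of_int (s x) * b x) f = expect m d p b (\<lambda>z. f (flip m s z))"
  unfolding expect_def
  by (rule sum.reindex_bij_witness[of _ "flip m s" "flip m s"])
     (use assms in \<open>auto simp: flip_flip flip_in_samples sample_wt_flip[symmetric]\<close>)

text \<open>The symmetry behind the Bayes argument: the loss of majority voting depends on
  \<open>s x\<close> times the vote, and the two sign changes cancel because the square of
  \<open>s x\<close> is 1.\<close>

lemma expect_vote_sign:
  assumes "s \<in> hypotheses d" "x \<in> {1..d}"
  shows "expect m d p (\<lambda>x. real_of_int (s x) * b x) (\<lambda>z. g (s x * vote m z x))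
    = expect m d p b (\<lambda>z. g (vote m z x))"
proof -
  have "s x * (s x * v) = v" for v using assms by (cases rule: hypothesis_cases) auto
  then show ?thesis by (simp only: expect_flip[OF assms(1)] vote_flip)
qed

text \<open>Isolates the likelihood as a function of the bias at x alone: k and l count the labels 1
  and -1 seen at x, and R collects the observations at all other points. None of the three depends
  on c.\<close>

lemma sample_wt_split:
  assumes z: "z \<in> samples m d"
  obtains R :: real and k l :: nat where "vote m z x = int k - int l"
    "(p, b) \<in> params d \<Longrightarrow> 0 \<le> R"
    "\<And>c. sample_wt m p (b(x := c)) z = (p x * (1 / 2 + c / 2)) ^ k * (p x * (1 / 2 - c / 2)) ^ l * R"
proof -
  define A where "A = {i\<in>{1..m}. z i = (x, 1)}"
  define B where "B = {i\<in>{1..m}. z i = (x, -1)}"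
  define C where "C = {i\<in>{1..m}. fst (z i) \<noteq> x}"
  have U: "{1..m} = A \<union> B \<union> C"
  proof (intro equalityI subsetI)
    fix i assume "i \<in> {1..m}"
    with sampleD(2)[OF z this] show "i \<in> A \<union> B \<union> C"
      by (cases "z i") (auto simp: A_def B_def C_def)
  qed (auto simp: A_def B_def C_def)
  have dis: "A \<inter> B = {}" "(A \<union> B) \<inter> C = {}" and fin: "finite A" "finite B" "finite C"
    by (auto simp: A_def B_def C_def)
  show ?thesis
  proof (rule that[of "card A" "card B" "\<Prod>i\<in>C. wt p b (z i)"])
    have "vote m z x = (\<Sum>i\<in>A. snd (z i) * of_bool (fst (z i) = x)) + (\<Sum>i\<in>B. snd (z i) * of_bool (fst (z i) = x))
      + (\<Sum>i\<in>C. snd (z i) * of_bool (fst (z i) = x))"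
      unfolding vote_def U by (simp only: sum.union_disjoint finite_Un fin dis simp_thms)
    also have "\<dots> = int (card A) - int (card B)" by (simp add: A_def B_def C_def)
    finally show "vote m z x = int (card A) - int (card B)" .
  next
    assume "(p, b) \<in> params d"
    then show "0 \<le> (\<Prod>i\<in>C. wt p b (z i))"
      by (intro prod_nonneg wt_nonneg) (use z in \<open>auto simp: C_def samples_def\<close>)
  next
    fix c
    have "sample_wt m p (b(x := c)) z = (\<Prod>i\<in>A. wt p (b(x := c)) (z i)) * (\<Prod>i\<in>B. wt p (b(x := c)) (z i))
      * (\<Prod>i\<in>C. wt p (b(x := c)) (z i))"
      unfolding sample_wt_def U using fin dis by (simp add: prod.union_disjoint)
    also have "(\<Prod>i\<in>A. wt p (b(x := c)) (z i)) = (p x * (1 / 2 + c / 2)) ^ card A"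
      by (simp add: A_def wt_def)
    also have "(\<Prod>i\<in>B. wt p (b(x := c)) (z i)) = (p x * (1 / 2 - c / 2)) ^ card B"
      by (simp add: B_def wt_def)
    also have "(\<Prod>i\<in>C. wt p (b(x := c)) (z i)) = (\<Prod>i\<in>C. wt p b (z i))"
      by (rule prod.cong) (auto simp: C_def wt_def split: prod.splits)
    finally show "sample_wt m p (b(x := c)) z = (p x * (1 / 2 + c / 2)) ^ card A * (p x * (1 / 2 - c / 2)) ^ card B
      * (\<Prod>i\<in>C. wt p b (z i))" .
  qed
qed

text \<open>Free of quotients so that it covers \<open>w = 0\<close>, which arises for a bias of
  absolute value 1, where the posterior odds are not finite. After splitting off
  \<open>u ^ k * w ^ k\<close> only \<open>w ^ j \<le> u ^ j\<close> with \<open>j = l - k\<close>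
  remains.\<close>

lemma power_rearrangement:
  fixes u w :: "'a::linordered_semidom"
  assumes "0 \<le> w" "w \<le> u" "k \<le> l"
  shows "u ^ k * w ^ l \<le> w ^ k * u ^ l"
proof -
  from assms(3) obtain j where l: "l = k + j" using le_Suc_ex by blast
  have "w ^ j \<le> u ^ j" using assms by (intro power_mono) auto
  then have "(u ^ k * w ^ k) * w ^ j \<le> (u ^ k * w ^ k) * u ^ j"
    using assms by (intro mult_left_mono mult_nonneg_nonneg zero_le_power) auto
  then show ?thesis by (simp add: l power_add mult_ac)
qed

text \<open>Changing the sign of the bias at x exchanges the two label probabilities there and
  leaves all other factors alone, so the sign of k - l decides which likelihood is larger. At a tie
  both inequalities hold.\<close>

lemma sample_wt_mono_vote:
  assumes "(p, b) \<in> params d" "z \<in> samples m d" "x \<in> {1..d}" "0 \<le> b x"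
  shows "vote m z x \<le> 0 \<Longrightarrow> sample_wt m p b z \<le> sample_wt m p (b(x := - b x)) z"
    and "0 \<le> vote m z x \<Longrightarrow> sample_wt m p (b(x := - b x)) z \<le> sample_wt m p b z"
proof -
  obtain R :: real and k l where *: "vote m z x = int k - int l" "0 \<le> R"
    "\<And>c. sample_wt m p (b(x := c)) z = (p x * (1 / 2 + c / 2)) ^ k * (p x * (1 / 2 - c / 2)) ^ l * R"
    using sample_wt_split[OF assms(2), of x p b] assms(1) by metis
  have 1: "0 \<le> p x * (1 / 2 - b x / 2)"
    using params_D(1,3)[OF assms(1,3)] assms(4) by (intro mult_nonneg_nonneg) auto
  have 2: "p x * (1 / 2 - b x / 2) \<le> p x * (1 / 2 + b x / 2)"
    using params_D(1)[OF assms(1,3)] assms(4) by (intro mult_left_mono) auto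
  note pr = power_rearrangement[OF 1 2]
  note eq = *(3)[of "b x", simplified] *(3)[of "- b x"]
  show "sample_wt m p b z \<le> sample_wt m p (b(x := - b x)) z" if "vote m z x \<le> 0"
    unfolding eq using pr[of k l] that *(1,2) by (intro mult_right_mono) auto
  show "sample_wt m p (b(x := - b x)) z \<le> sample_wt m p b z" if "0 \<le> vote m z x"
    unfolding eq using pr[of l k] that *(1,2) by (intro mult_right_mono) (auto simp: mult_ac)
qed

definition vote_loss :: "int \<Rightarrow> real" where
  "vote_loss v = of_bool (v < 0) + of_bool (v = 0) / 2"

text \<open>Majority voting with fair tie breaking is the Bayes rule for a uniformly random sign of \<open>b x\<close>.\<close>

lemma bayes_pair:
  assumes "(p, b) \<in> params d" "z \<in> samples m d" "x \<in> {1..d}" "0 \<le> b x" "0 \<le> q" "q \<le> 1"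
  shows "sample_wt m p b z * vote_loss (vote m z x) + sample_wt m p (b(x := - b x)) z * vote_loss (- vote m z x)
    \<le> sample_wt m p b z * q + sample_wt m p (b(x := - b x)) z * (1 - q)"
proof -
  let ?u = "sample_wt m p b z" and ?w = "sample_wt m p (b(x := - b x)) z"
  note mono = sample_wt_mono_vote[where b = b, OF assms(1-4)]
  consider "vote m z x < 0" | "vote m z x = 0" | "vote m z x > 0" by linarith
  then show ?thesis
  proof cases
    case 1
    then have "?u * (1 - q) \<le> ?w * (1 - q)" using mono(1) assms by (intro mult_right_mono) auto
    with 1 show ?thesis by (simp add: vote_loss_def algebra_simps)
  next
    case 2
    with mono have "?u = ?w" by simp
    with 2 show ?thesis by (simp add: vote_loss_def algebra_simps)
  next
    case 3
    then have "?w * q \<le> ?u * q" using mono(2) assms by (intro mult_right_mono) auto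
    with 3 show ?thesis by (simp add: vote_loss_def algebra_simps)
  qed
qed

text \<open>Here \<open>q y\<close> stands for the probability of a wrong guess when the sign at x
  is y; the two add up to 1 since any guess is wrong for exactly one sign. Sign vectors that differ
  only at x are paired, which leaves the comparison of two likelihoods.\<close>

lemma bayes_sum:
  fixes q :: "int \<Rightarrow> real"
  assumes "(p, b) \<in> params d" "z \<in> samples m d" "x \<in> {1..d}" "0 \<le> b x"
    and q: "0 \<le> q 1" "0 \<le> q (-1)" "q 1 + q (-1) = 1"
  shows "(\<Sum>s\<in>hypotheses d. sample_wt m p (\<lambda>x. real_of_int (s x) * b x) z * vote_loss (s x * vote m z x))
    \<le> (\<Sum>s\<in>hypotheses d. sample_wt m p (\<lambda>x. real_of_int (s x) * b x) z * q (s x))"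
proof -
  let ?w = "\<lambda>s. sample_wt m p (\<lambda>x. real_of_int (s x) * b x) z"
  let ?f = "\<lambda>s. s(x := - s x)"
  have sym: "(\<Sum>s\<in>hypotheses d. F (?f s)) = (\<Sum>s\<in>hypotheses d. F s)" for F :: "_ \<Rightarrow> real"
    by (rule sum.reindex_bij_witness[of _ ?f ?f])
       (use assms(3) in \<open>auto simp: hypotheses_def PiE_def Pi_def extensional_def\<close>)
  \<comment> \<open>Each pair is counted twice, so that no representative of a pair has to be
    chosen.\<close>
  have double: "2 * (\<Sum>s\<in>hypotheses d. F s) = (\<Sum>s\<in>hypotheses d. F s + F (?f s))" for F :: "_ \<Rightarrow> real"
    by (simp add: sum.distrib sym)
  have pair: "?w s * vote_loss (s x * vote m z x) + ?w (?f s) * vote_loss (- s x * vote m z x)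
    \<le> ?w s * q (s x) + ?w (?f s) * q (- s x)" if s: "s \<in> hypotheses d" for s
  proof -
    let ?b = "\<lambda>y. real_of_int (s y) * b y"
    have par: "(p, ?b) \<in> params d"
    proof (rule params_sign[OF assms(1)])
      fix y assume "y \<in> {1..d}"
      with s show "\<bar>?b y\<bar> = \<bar>b y\<bar>" by (cases rule: hypothesis_cases) auto
    qed
    have upd: "(\<lambda>y. real_of_int ((?f s) y) * b y) = ?b(x := - ?b x)" by auto
    from s assms(3) show ?thesis
    proof (cases rule: hypothesis_cases)
      case 1
      have "0 \<le> ?b x" "0 \<le> q 1" "q 1 \<le> 1" "q (-1) = 1 - q 1" using 1 assms(4) q by auto
      with bayes_pair[OF par assms(2,3), of "q 1"] show ?thesis
        unfolding upd using 1 by simp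
    next
      case 2
      \<comment> \<open>For \<open>s x = -1\<close> the pair is the same with its members exchanged,
        so the comparison is applied at the flipped vector, whose bias at x is nonnegative.\<close>
      have par': "(p, ?b(x := - ?b x)) \<in> params d"
        by (rule params_sign[OF par]) auto
      have "0 \<le> (?b(x := - ?b x)) x" "0 \<le> q 1" "q 1 \<le> 1" "q (-1) = 1 - q 1" using 2 assms(4) q by auto
      moreover have "(?b(x := - ?b x))(x := - (?b(x := - ?b x)) x) = ?b" by auto
      ultimately show ?thesis
        using bayes_pair[OF par' assms(2,3), of "q 1"] unfolding upd using 2 by simp
    qed
  qed
  have "2 * (\<Sum>s\<in>hypotheses d. ?w s * vote_loss (s x * vote m z x))
    \<le> 2 * (\<Sum>s\<in>hypotheses d. ?w s * q (s x))"
    unfolding double by (rule sum_mono) (use pair in simp)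
  then show ?thesis by simp
qed

text \<open>The risk averaged over all sign vectors is at least the claimed sum, hence some sign
  vector reaches it. Interchanging the sums leaves, for each fixed point and sample, the problem of
  guessing one sign; by symmetry the Bayes value is the same for every s.\<close>

lemma bayes_lower_bound:
  assumes par: "(p, b) \<in> params d" and L: "L \<in> rand_learners m d" and b0: "\<And>x. x \<in> {1..d} \<Longrightarrow> 0 \<le> b x"
  obtains D where "D \<in> distributions d"
    "(\<Sum>x=1..d. p x * b x * expect m d p b (\<lambda>z. vote_loss (vote m z x))) \<le> rand_risk m d L D"
proof -
  interpret U: prob_space uniform_law by (rule prob_space_uniform_law)
  define \<beta> where "\<beta> s x = real_of_int (s x) * b x" for s :: "nat \<Rightarrow> int" and x
  \<comment> \<open>The conditional probability, given the sample z, that the label chosen at x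
    differs from y: for labels in {-1, 1} the indicator of a mismatch is (1 - product) / 2.\<close>
  define q where "q z x y = (\<integral>u. (1 - real_of_int (L z u x) * real_of_int y) / 2 \<partial>uniform_law)" for z x and y :: int
  let ?lb = "\<Sum>x=1..d. p x * b x * expect m d p b (\<lambda>z. vote_loss (vote m z x))"
  have par_s: "(p, \<beta> s) \<in> params d" if s: "s \<in> hypotheses d" for s
  proof (rule params_sign[OF par])
    fix y assume "y \<in> {1..d}"
    with s show "\<bar>\<beta> s y\<bar> = \<bar>b y\<bar>" by (cases rule: hypothesis_cases) (auto simp: \<beta>_def)
  qed
  have int: "integrable uniform_law (\<lambda>u. real_of_int (L z u x))" if "z \<in> samples m d" "x \<in> {1..d}" for z x
  proof (rule U.integrable_const_bound[of _ 1])
    show "AE u in uniform_law. norm (real_of_int (L z u x)) \<le> 1"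
    proof (rule AE_I2)
      fix u assume "u \<in> space uniform_law"
      from rand_learner_in_hypotheses[OF L that(1) this] that(2)
      show "norm (real_of_int (L z u x)) \<le> 1" by (cases rule: hypothesis_cases) auto
    qed
    have "L z \<in> uniform_law \<rightarrow>\<^sub>M count_space (hypotheses d)"
      using L that by (auto simp: rand_learners_def uniform_law_measurable_cong)
    from measurable_compose[OF this, of "\<lambda>h. real_of_int (h x)" borel]
    show "(\<lambda>u. real_of_int (L z u x)) \<in> borel_measurable uniform_law" by simp
  qed
  have q_nonneg: "0 \<le> q z x y" if "z \<in> samples m d" "x \<in> {1..d}" "y = 1 \<or> y = -1" for z x y
    unfolding q_def
  proof (rule integral_nonneg_AE, rule AE_I2)
    fix u assume "u \<in> space uniform_law"
    from rand_learner_in_hypotheses[OF L that(1) this] that(2)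
    show "0 \<le> (1 - real_of_int (L z u x) * real_of_int y) / 2"
      by (cases rule: hypothesis_cases) (use that(3) in auto)
  qed
  have q_sum: "q z x 1 + q z x (-1) = 1" if "z \<in> samples m d" "x \<in> {1..d}" for z x
    unfolding q_def using int[OF that] U.prob_space by (simp add: field_simps)
  have risk: "rand_risk m d L (param_dist d p (\<beta> s))
      = (\<Sum>x=1..d. p x * b x * expect m d p (\<beta> s) (\<lambda>z. q z x (s x)))" if s: "s \<in> hypotheses d" for s
  proof -
    have "(\<integral>u. excess d (L z u) (param_dist d p (\<beta> s)) \<partial>uniform_law) = (\<Sum>x=1..d. p x * b x * q z x (s x))"
      if z: "z \<in> samples m d" for z
    proof -
      have "(\<integral>u. excess d (L z u) (param_dist d p (\<beta> s)) \<partial>uniform_law)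
        = (\<integral>u. (\<Sum>x=1..d. p x * b x * ((1 - real_of_int (L z u x) * real_of_int (s x)) / 2)) \<partial>uniform_law)"
      proof (rule Bochner_Integration.integral_cong)
        fix u assume u: "u \<in> space uniform_law"
        show "excess d (L z u) (param_dist d p (\<beta> s))
          = (\<Sum>x=1..d. p x * b x * ((1 - real_of_int (L z u x) * real_of_int (s x)) / 2))"
          unfolding excess_param_dist[OF par_s[OF s] rand_learner_in_hypotheses[OF L z u]]
        proof (rule sum.cong)
          fix x assume x: "x \<in> {1..d}"
          then have "\<bar>\<beta> s x\<bar> = b x" using b0[OF x]
            by (rule_tac hypothesis_cases[OF s x]) (auto simp: \<beta>_def)
          then show "p x * (\<bar>\<beta> s x\<bar> - real_of_int (L z u x) * \<beta> s x) / 2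
            = p x * b x * ((1 - real_of_int (L z u x) * real_of_int (s x)) / 2)"
            by (simp only:) (simp add: \<beta>_def algebra_simps)
        qed simp
      qed simp
      also have "\<dots> = (\<Sum>x=1..d. \<integral>u. p x * b x * ((1 - real_of_int (L z u x) * real_of_int (s x)) / 2) \<partial>uniform_law)"
        by (rule Bochner_Integration.integral_sum) (use int[OF z] in auto)
      also have "\<dots> = (\<Sum>x=1..d. p x * b x * q z x (s x))" by (simp add: q_def)
      finally show ?thesis .
    qed
    then show ?thesis
      unfolding rand_risk_eq[OF par_s[OF s] L]
      by (subst expect_cmult[symmetric], subst expect_sum[symmetric], intro expect_cong) auto
  qed
  have "(\<Sum>s\<in>hypotheses d. ?lb) = (\<Sum>s\<in>hypotheses d. \<Sum>x=1..d. p x * b x * expect m d p (\<beta> s) (\<lambda>z. vote_loss (s x * vote m z x)))"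
    unfolding \<beta>_def by (intro sum.cong refl) (simp add: expect_vote_sign)
  also have "\<dots> = (\<Sum>x=1..d. p x * b x * (\<Sum>z\<in>samples m d. \<Sum>s\<in>hypotheses d. sample_wt m p (\<beta> s) z * vote_loss (s x * vote m z x)))"
    unfolding expect_def sum_distrib_left real_scaleR_def
    by (subst sum.swap, intro sum.cong refl, subst sum.swap, rule refl)
  also have "\<dots> \<le> (\<Sum>x=1..d. p x * b x * (\<Sum>z\<in>samples m d. \<Sum>s\<in>hypotheses d. sample_wt m p (\<beta> s) z * q z x (s x)))"
    unfolding \<beta>_def
    by (intro sum_mono mult_left_mono bayes_sum mult_nonneg_nonneg)
       (use par b0 q_nonneg q_sum params_D(1)[OF par] in auto)
  also have "\<dots> = (\<Sum>s\<in>hypotheses d. \<Sum>x=1..d. p x * b x * expect m d p (\<beta> s) (\<lambda>z. q z x (s x)))"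
    unfolding expect_def sum_distrib_left real_scaleR_def
    by (subst (2) sum.swap, intro sum.cong refl, subst sum.swap, rule refl)
  also have "\<dots> = (\<Sum>s\<in>hypotheses d. rand_risk m d L (param_dist d p (\<beta> s)))"
    by (intro sum.cong refl) (simp add: risk)
  finally have *: "(\<Sum>s\<in>hypotheses d. ?lb) \<le> (\<Sum>s\<in>hypotheses d. rand_risk m d L (param_dist d p (\<beta> s)))" .
  have "\<exists>s\<in>hypotheses d. ?lb \<le> rand_risk m d L (param_dist d p (\<beta> s))"
  proof (rule ccontr)
    assume "\<not> ?thesis"
    then have "(\<Sum>s\<in>hypotheses d. rand_risk m d L (param_dist d p (\<beta> s))) < (\<Sum>s\<in>hypotheses d. ?lb)"
      by (intro sum_strict_mono) (auto simp: not_le hypotheses_nonempty)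
    with * show False by simp
  qed
  then show ?thesis using that param_dist_in_distributions[OF par_s] by blast
qed


section \<open>The risk of an empirical risk minimizer\<close>

lemma hypotheses_sgn: "(\<lambda>x\<in>{1..d}. if b x \<ge> 0 then 1 else - 1) \<in> hypotheses d" for b :: "nat \<Rightarrow> real"
  by (auto simp: hypotheses_def)

text \<open>The choice at a tie is unknown, so a tie is charged as a full error. The sign symmetry
  then replaces the biases by their absolute values, the form in which the lower bound is
  stated.\<close>

lemma ERM_risk_le:
  assumes "is_ERM m d L" "(p, b) \<in> params d"
  shows "risk m d L (param_dist d p b)
    \<le> (\<Sum>x=1..d. p x * \<bar>b x\<bar> * expect m d p (\<lambda>x. \<bar>b x\<bar>) (\<lambda>z. of_bool (vote m z x \<le> 0)))"
proof -
  define s :: "nat \<Rightarrow> int" where "s = (\<lambda>x\<in>{1..d}. if b x \<ge> 0 then 1 else - 1)"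
  have s: "s \<in> hypotheses d" unfolding s_def by (rule hypotheses_sgn)
  have bs: "b x = real_of_int (s x) * \<bar>b x\<bar>" if "x \<in> {1..d}" for x using that by (simp add: s_def)
  have exc: "excess d (L z) (param_dist d p b) \<le> (\<Sum>x=1..d. p x * \<bar>b x\<bar> * of_bool (s x * vote m z x \<le> 0))"
    if z: "z \<in> samples m d" for z
  proof -
    have Lz: "L z \<in> hypotheses d" using assms(1) z by (auto simp: is_ERM_def learners_def)
    show ?thesis unfolding excess_param_dist[OF assms(2) Lz]
    proof (rule sum_mono)
      fix x assume x: "x \<in> {1..d}"
      have "L z x = s x" if "s x * vote m z x > 0"
        using assms(1) z x that s by (cases rule: hypothesis_cases[OF s x]) (auto simp: is_ERM_def)
      moreover have "real_of_int (s x) * b x = \<bar>b x\<bar>" using x by (simp add: s_def)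
      moreover have "\<bar>b x\<bar> - real_of_int (L z x) * b x \<le> 2 * \<bar>b x\<bar>"
        by (cases rule: hypothesis_cases[OF Lz x]) auto
      ultimately have "\<bar>b x\<bar> - real_of_int (L z x) * b x \<le> 2 * \<bar>b x\<bar> * of_bool (s x * vote m z x \<le> 0)"
        by (cases "s x * vote m z x \<le> 0") auto
      with params_D(1)[OF assms(2) x] have "p x * (\<bar>b x\<bar> - real_of_int (L z x) * b x)
        \<le> p x * (2 * \<bar>b x\<bar> * of_bool (s x * vote m z x \<le> 0))" by (intro mult_left_mono)
      then show "p x * (\<bar>b x\<bar> - real_of_int (L z x) * b x) / 2 \<le> p x * \<bar>b x\<bar> * of_bool (s x * vote m z x \<le> 0)"
        by simp
    qed
  qed
  have par': "(p, \<lambda>x. real_of_int (s x) * \<bar>b x\<bar>) \<in> params d"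
    by (rule params_sign[OF assms(2)]) (use bs in \<open>auto simp: abs_mult s_def\<close>)
  \<comment> \<open>The two bias functions agree on \<open>{1..d}\<close> but may differ outside it,
    so the expectations are compared through the weights of the samples.\<close>
  have cong: "expect m d p b f = expect m d p (\<lambda>x. real_of_int (s x) * \<bar>b x\<bar>) f" for f :: "sample \<Rightarrow> real"
  proof -
    have "sample_wt m p b z = sample_wt m p (\<lambda>x. real_of_int (s x) * \<bar>b x\<bar>) z" if "z \<in> samples m d" for z
      unfolding sample_wt_def wt_def
    proof (rule prod.cong)
      fix i assume "i \<in> {1..m}"
      from bs[OF sampleD(1)[OF that this]]
      show "(case z i of (x, y) \<Rightarrow> p x * (1 / 2 + real_of_int y * b x / 2))
        = (case z i of (x, y) \<Rightarrow> p x * (1 / 2 + real_of_int y * (real_of_int (s x) * \<bar>b x\<bar>) / 2))"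
        by (cases "z i") simp
    qed simp
    then show ?thesis by (simp add: expect_def)
  qed
  have "risk m d L (param_dist d p b) \<le> expect m d p b (\<lambda>z. \<Sum>x=1..d. p x * \<bar>b x\<bar> * of_bool (s x * vote m z x \<le> 0))"
    unfolding risk_eq[OF assms(2)] by (rule expect_mono[OF assms(2)]) (rule exc)
  also have "\<dots> = (\<Sum>x=1..d. p x * \<bar>b x\<bar> * expect m d p b (\<lambda>z. of_bool (s x * vote m z x \<le> 0)))"
    by (simp only: expect_sum expect_cmult)
  also have "\<dots> = (\<Sum>x=1..d. p x * \<bar>b x\<bar> * expect m d p (\<lambda>x. \<bar>b x\<bar>) (\<lambda>z. of_bool (vote m z x \<le> 0)))"
    unfolding cong by (intro sum.cong refl) (simp only: expect_vote_sign[OF s, where g = "\<lambda>v. of_bool (v \<le> 0)"])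
  finally show ?thesis .
qed

section \<open>Suprema and infima of risks\<close>

lemma risk_bounds:
  assumes "D \<in> distributions d" "L \<in> learners m d"
  shows "0 \<le> risk m d L D" "risk m d L D \<le> 1"
proof -
  from assms(1) obtain p b where D: "(p, b) \<in> params d" "D = param_dist d p b" by (rule distributions_cases)
  have "0 \<le> excess d (L z) D \<and> excess d (L z) D \<le> 1" if "z \<in> samples m d" for z
    using excess_bounds[OF assms(1)] assms(2) that by (auto simp: learners_def)
  then have "expect m d p b (\<lambda>_. 0) \<le> risk m d L D" "risk m d L D \<le> expect m d p b (\<lambda>_. 1)"
    unfolding D(2) risk_eq[OF D(1)] by (auto intro!: expect_mono D(1))
  then show "0 \<le> risk m d L D" "risk m d L D \<le> 1" by (simp_all add: expect_const[OF D(1)])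
qed

lemma rand_risk_bounds:
  assumes "D \<in> distributions d" "L \<in> rand_learners m d"
  shows "0 \<le> rand_risk m d L D" "rand_risk m d L D \<le> 1"
proof -
  interpret U: prob_space uniform_law by (rule prob_space_uniform_law)
  from assms(1) obtain p b where D: "(p, b) \<in> params d" "D = param_dist d p b" by (rule distributions_cases)
  have "0 \<le> (\<integral>u. excess d (L z u) D \<partial>uniform_law) \<and> (\<integral>u. excess d (L z u) D \<partial>uniform_law) \<le> 1"
    if z: "z \<in> samples m d" for z
  proof -
    have *: "0 \<le> excess d (L z u) D" "excess d (L z u) D \<le> 1" if "u \<in> space uniform_law" for u
      using excess_bounds[OF assms(1) rand_learner_in_hypotheses[OF assms(2) z that]] by auto
    have "L z \<in> uniform_law \<rightarrow>\<^sub>M count_space (hypotheses d)"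
      using assms(2) z by (auto simp: rand_learners_def uniform_law_measurable_cong)
    from measurable_compose[OF this, of "\<lambda>h. excess d h D" borel]
    have "integrable uniform_law (\<lambda>u. excess d (L z u) D)"
      by (intro U.integrable_const_bound[of _ 1] AE_I2) (use * in auto)
    then show ?thesis using * by (auto intro!: integral_nonneg_AE U.integral_le_const AE_I2)
  qed
  then have "expect m d p b (\<lambda>_. 0) \<le> rand_risk m d L D" "rand_risk m d L D \<le> expect m d p b (\<lambda>_. 1)"
    unfolding D(2) rand_risk_eq[OF D(1) assms(2)] by (auto intro!: expect_mono D(1))
  then show "0 \<le> rand_risk m d L D" "rand_risk m d L D \<le> 1" by (simp_all add: expect_const[OF D(1)])
qed

lemma distributions_nonempty: "d \<ge> 1 \<Longrightarrow> distributions d \<noteq> {}"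
  using param_dist_in_distributions[of "\<lambda>x. of_bool (x = 1)" "\<lambda>_. 0" d]
  by (auto simp: params_def of_bool_def)

lemma bdd_above_risk: "L \<in> learners m d \<Longrightarrow> bdd_above (risk m d L ` distributions d)"
  by (auto intro!: bdd_aboveI2 risk_bounds)

lemma bdd_above_rand_risk: "L \<in> rand_learners m d \<Longrightarrow> bdd_above (rand_risk m d L ` distributions d)"
  by (auto intro!: bdd_aboveI2 rand_risk_bounds)

lemma deterministic_rand_learner:
  assumes "L \<in> learners m d"
  shows "(\<lambda>z u. L z) \<in> rand_learners m d"
    and "D \<in> distributions d \<Longrightarrow> rand_risk m d (\<lambda>z u. L z) D = risk m d L D"
proof -
  interpret U: prob_space uniform_law by (rule prob_space_uniform_law)
  show *: "(\<lambda>z u. L z) \<in> rand_learners m d"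
    using assms by (auto simp: rand_learners_def learners_def Pi_iff)
  assume "D \<in> distributions d"
  then obtain p b where D: "(p, b) \<in> params d" "D = param_dist d p b" by (rule distributions_cases)
  show "rand_risk m d (\<lambda>z u. L z) D = risk m d L D"
    unfolding D(2) rand_risk_eq[OF D(1) *] risk_eq[OF D(1)] by (simp add: U.prob_space)
qed

lemma learners_nonempty: "learners m d \<noteq> {}"
  using hypotheses_nonempty[of d] by (auto simp: learners_def Pi_def)

lemma minimax_rand_le_minimax:
  assumes "d \<ge> 1"
  shows "minimax_rand_risk m d \<le> minimax_risk m d"
  unfolding minimax_risk_def
proof (rule cINF_greatest[OF learners_nonempty])
  fix L assume L: "L \<in> learners m d"
  have "minimax_rand_risk m d \<le> (SUP D\<in>distributions d. rand_risk m d (\<lambda>z u. L z) D)"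
    unfolding minimax_rand_risk_def
  proof (rule cINF_lower[OF _ deterministic_rand_learner(1)[OF L]])
    obtain D where D: "D \<in> distributions d" using distributions_nonempty[OF assms] by blast
    show "bdd_below ((\<lambda>L. SUP D\<in>distributions d. rand_risk m d L D) ` rand_learners m d)"
    proof (rule bdd_belowI2)
      fix L assume "L \<in> rand_learners m d"
      then show "0 \<le> (SUP D\<in>distributions d. rand_risk m d L D)"
        by (intro cSUP_upper2[OF bdd_above_rand_risk D] rand_risk_bounds D)
    qed
  qed
  also have "\<dots> = (SUP D\<in>distributions d. risk m d L D)"
    by (intro SUP_cong refl deterministic_rand_learner(2)[OF L])
  finally show "minimax_rand_risk m d \<le> (SUP D\<in>distributions d. risk m d L D)" .
qed

lemma minimax_le_worst:
  assumes "d \<ge> 1" "L \<in> learners m d"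
  shows "minimax_risk m d \<le> worst_risk m d L"
  unfolding minimax_risk_def worst_risk_def
proof (rule cINF_lower[OF _ assms(2)])
  obtain D where D: "D \<in> distributions d" using distributions_nonempty[OF assms(1)] by blast
  show "bdd_below ((\<lambda>L. SUP D\<in>distributions d. risk m d L D) ` learners m d)"
  proof (rule bdd_belowI2)
    fix L assume "L \<in> learners m d"
    then show "0 \<le> (SUP D\<in>distributions d. risk m d L D)"
      by (intro cSUP_upper2[OF bdd_above_risk D] risk_bounds D)
  qed
qed

lemma params_abs: "(p, b) \<in> params d \<Longrightarrow> (p, \<lambda>x. \<bar>b x\<bar>) \<in> params d"
  by (erule params_sign) simp

text \<open>Used twice: at the parameters of an arbitrary distribution it cancels the main part of
  the risk of an empirical risk minimizer, and at uniform p with constant b it yields the asymptotic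
  lower bound.\<close>

lemma minimax_rand_lower:
  assumes "(p, b) \<in> params d"
  shows "(\<Sum>x=1..d. p x * \<bar>b x\<bar> * expect m d p (\<lambda>x. \<bar>b x\<bar>) (\<lambda>z. vote_loss (vote m z x))) \<le> minimax_rand_risk m d"
  unfolding minimax_rand_risk_def
proof (rule cINF_greatest)
  show "rand_learners m d \<noteq> {}" using learners_nonempty deterministic_rand_learner(1) by blast
  fix L assume L: "L \<in> rand_learners m d"
  obtain D where "D \<in> distributions d"
    "(\<Sum>x=1..d. p x * \<bar>b x\<bar> * expect m d p (\<lambda>x. \<bar>b x\<bar>) (\<lambda>z. vote_loss (vote m z x))) \<le> rand_risk m d L D"
    using bayes_lower_bound[OF params_abs[OF assms] L] by auto
  then show "(\<Sum>x=1..d. p x * \<bar>b x\<bar> * expect m d p (\<lambda>x. \<bar>b x\<bar>) (\<lambda>z. vote_loss (vote m z x)))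
      \<le> (SUP D\<in>distributions d. rand_risk m d L D)"
    by (intro cSUP_upper2[OF bdd_above_rand_risk[OF L]])
qed

lemma tie_prob_bounds:
  assumes "(p, b) \<in> params d"
  shows "0 \<le> tie_prob m d p b x" "tie_prob m d p b x \<le> 1"
proof -
  interpret prob_space "param_dist d p b" by (rule prob_space_param_dist[OF assms])
  interpret S: prob_space "sample_law m (param_dist d p b)"
    unfolding sample_law_def by (rule prob_space_PiM) (rule prob_space_axioms)
  show "0 \<le> tie_prob m d p b x" "tie_prob m d p b x \<le> 1" by (simp_all add: tie_prob_def)
qed

lemma tie_sum_bounds:
  assumes "(p, b) \<in> params d"
  shows "0 \<le> (\<Sum>x=1..d. p x * \<bar>b x\<bar> * tie_prob m d p b x)" "(\<Sum>x=1..d. p x * \<bar>b x\<bar> * tie_prob m d p b x) \<le> 1"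
proof -
  note * = params_D[OF assms] tie_prob_bounds[OF assms, of m]
  show "0 \<le> (\<Sum>x=1..d. p x * \<bar>b x\<bar> * tie_prob m d p b x)"
    by (intro sum_nonneg mult_nonneg_nonneg * abs_ge_zero)
  have "(\<Sum>x=1..d. p x * \<bar>b x\<bar> * tie_prob m d p b x) \<le> (\<Sum>x=1..d. p x)"
  proof (rule sum_mono)
    fix x assume x: "x \<in> {1..d}"
    have "\<bar>b x\<bar> * tie_prob m d p b x \<le> 1" using *(3)[OF x] *(5,6)[of x] by (intro mult_le_one) auto
    then show "p x * \<bar>b x\<bar> * tie_prob m d p b x \<le> p x"
      using mult_left_mono[of "\<bar>b x\<bar> * tie_prob m d p b x" 1 "p x"] *(1)[OF x] by (simp add: mult_ac)
  qed
  then show "(\<Sum>x=1..d. p x * \<bar>b x\<bar> * tie_prob m d p b x) \<le> 1" using *(4) by simp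
qed

lemma tie_bound_ge:
  assumes "(p, b) \<in> params d"
  shows "(\<Sum>x=1..d. p x * \<bar>b x\<bar> * tie_prob m d p b x) / 2 \<le> tie_bound m d"
proof -
  have "bdd_above ((\<lambda>(p, b). \<Sum>x=1..d. p x * \<bar>b x\<bar> * tie_prob m d p b x) ` params d)"
    by (rule bdd_aboveI2[of _ _ 1]) (use tie_sum_bounds in auto)
  from cSUP_upper[OF assms this] show ?thesis by (simp add: tie_bound_def)
qed

text \<open>The whole gap between the upper and the lower bound: charging a tie fully instead of by
  one half.\<close>

lemma of_bool_nonpos_eq_vote_loss: "of_bool (v \<le> 0) = vote_loss v + of_bool (v = 0) / 2" for v :: int
  by (auto simp: vote_loss_def)

text \<open>The risk at D and the minimax risk are compared at the same p and |b|: D may not be the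
  worst distribution, but the random signs attached to its own |b| already bound the minimax risk
  from below.\<close>

lemma worst_ERM_le:
  assumes "d \<ge> 1" "is_ERM m d L"
  shows "worst_risk m d L \<le> minimax_rand_risk m d + tie_bound m d"
  unfolding worst_risk_def
proof (rule cSUP_least[OF distributions_nonempty[OF assms(1)]])
  fix D assume "D \<in> distributions d"
  then obtain p b where D: "(p, b) \<in> params d" "D = param_dist d p b" by (rule distributions_cases)
  let ?E = "expect m d p (\<lambda>x. \<bar>b x\<bar>)"
  have "risk m d L D \<le> (\<Sum>x=1..d. p x * \<bar>b x\<bar> * ?E (\<lambda>z. of_bool (vote m z x \<le> 0)))"
    unfolding D(2) by (rule ERM_risk_le[OF assms(2) D(1)])
  also have "\<dots> = (\<Sum>x=1..d. p x * \<bar>b x\<bar> * (?E (\<lambda>z. vote_loss (vote m z x))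
      + 1 / 2 * ?E (\<lambda>z. of_bool (vote m z x = 0))))"
    unfolding expect_cmult[symmetric] expect_add[symmetric] of_bool_nonpos_eq_vote_loss by simp
  also have "\<dots> = (\<Sum>x=1..d. p x * \<bar>b x\<bar> * ?E (\<lambda>z. vote_loss (vote m z x)))
      + (\<Sum>x=1..d. p x * \<bar>\<bar>b x\<bar>\<bar> * tie_prob m d p (\<lambda>x. \<bar>b x\<bar>) x) / 2"
    unfolding tie_prob_eq[OF params_abs[OF D(1)]] sum_divide_distrib sum.distrib[symmetric]
    by (intro sum.cong refl) (simp add: field_simps)
  also have "\<dots> \<le> minimax_rand_risk m d + tie_bound m d"
    by (intro add_mono minimax_rand_lower tie_bound_ge params_abs D(1))
  finally show "risk m d L D \<le> minimax_rand_risk m d + tie_bound m d" .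
qed

section \<open>Ties\<close>

text \<open>Squared to avoid roots. Successive central binomial coefficients have ratio
  2(2k+1)/(k+1), so the induction step is (2k+1)(2k+3) \<le> 4(k+1)^2.\<close>

lemma central_binomial_sq_le: "(real (2 * k choose k))\<^sup>2 * (2 * real k + 1) \<le> 16 ^ k"
proof (induction k)
  case (Suc k)
  define F f :: real where "F = fact (2 * k)" and "f = fact k"
  have f: "f \<noteq> 0" by (simp add: f_def)
  have C: "real (2 * k choose k) = F / (f * f)"
    using binomial_fact[of k "2 * k", where ?'a = real] by (simp add: F_def f_def)
  have "real (2 * Suc k choose Suc k) = fact (2 * Suc k) / (fact (Suc k) * fact (Suc k))"
    using binomial_fact[of "Suc k" "2 * Suc k", where ?'a = real] by (simp del: fact_Suc binomial_Suc_Suc)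
  also have "\<dots> = (2 * real k + 2) * (2 * real k + 1) * F / ((real k + 1) * f * ((real k + 1) * f))"
    by (simp add: F_def f_def algebra_simps)
  also have "\<dots> = F / (f * f) * (2 * (2 * real k + 1) / (real k + 1))"
    using f by (simp add: divide_simps) (simp add: algebra_simps)
  finally have rec: "real (2 * Suc k choose Suc k) = real (2 * k choose k) * (2 * (2 * real k + 1) / (real k + 1))"
    unfolding C .
  have "(2 * (2 * real k + 1) / (real k + 1))\<^sup>2 * (2 * real k + 3) \<le> 16 * (2 * real k + 1)"
    by (simp add: divide_simps power2_eq_square) (simp add: algebra_simps)
  from mult_left_mono[OF this, of "(real (2 * k choose k))\<^sup>2"]
  have "(real (2 * k choose k))\<^sup>2 * ((2 * (2 * real k + 1) / (real k + 1))\<^sup>2 * (2 * real k + 3))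
      \<le> (real (2 * k choose k))\<^sup>2 * (16 * (2 * real k + 1))" by simp
  also have "\<dots> \<le> 16 * 16 ^ k"
    using mult_left_mono[OF Suc.IH, of 16] by (simp add: algebra_simps)
  finally show ?case unfolding rec by (simp only: power_mult_distrib) (simp add: algebra_simps)
qed simp

text \<open>Each of the n + 1 terms of the geometric sum is at least \<open>t ^ n\<close>.\<close>

lemma power_times_one_minus_le:
  fixes t :: real
  assumes "0 \<le> t" "t \<le> 1"
  shows "(1 - t) * t ^ n * (real n + 1) \<le> 1"
proof -
  have "t ^ n * (real n + 1) = (\<Sum>j<Suc n. t ^ n)" by (simp add: algebra_simps)
  also have "\<dots> \<le> (\<Sum>j<Suc n. t ^ j)"
    using assms by (intro sum_mono power_decreasing) auto
  finally have "(1 - t) * (t ^ n * (real n + 1)) \<le> (1 - t) * (\<Sum>j<Suc n. t ^ j)"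
    using assms by (intro mult_left_mono) auto
  also have "\<dots> = 1 - t ^ Suc n" by (rule one_diff_power_eq[symmetric])
  also have "\<dots> \<le> 1" using assms by simp
  finally show ?thesis by (simp add: mult_ac)
qed

text \<open>At bias 0 the return probability is of order k^(-1/2). A larger \<beta> makes returns
  exponentially rare, and the weight |\<beta>| pays for a small one, which improves the order to
  1/k. In the square, with t = 1 - \<beta>^2, the two preceding lemmas each contribute one
  factor.\<close>

lemma central_binomial_bias_le:
  fixes \<beta> :: real
  assumes "\<bar>\<beta>\<bar> \<le> 1"
  shows "\<bar>\<beta>\<bar> * (real (2 * k choose k) * ((1 - \<beta>\<^sup>2) / 4) ^ k) \<le> 1 / (2 * real k + 1)"
proof (rule power2_le_imp_le)
  define t where "t = 1 - \<beta>\<^sup>2"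
  have t: "0 \<le> t" "t \<le> 1" using assms by (auto simp: t_def abs_square_le_1)
  have "(\<bar>\<beta>\<bar> * (real (2 * k choose k) * (t / 4) ^ k))\<^sup>2 * (2 * real k + 1)\<^sup>2
     = ((real (2 * k choose k))\<^sup>2 * (2 * real k + 1)) * ((1 - t) * t ^ (2 * k) * (real (2 * k) + 1)) / 16 ^ k"
  proof -
    have "((t / 4) ^ k)\<^sup>2 = t ^ (2 * k) / 16 ^ k"
    proof -
      have "((t / 4) ^ k)\<^sup>2 = ((t / 4)\<^sup>2) ^ k" by (metis power_mult mult.commute)
      also have "(t / 4)\<^sup>2 = t\<^sup>2 / 16" by (simp add: power_divide)
      finally show ?thesis by (simp only: power_divide power_mult)
    qed
    moreover have "\<bar>\<beta>\<bar>\<^sup>2 = 1 - t" by (simp add: t_def)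
    ultimately show ?thesis by (simp only: power_mult_distrib) (simp add: power2_eq_square[of "2 * real k + 1"])
  qed
  also have "\<dots> \<le> 16 ^ k * 1 / 16 ^ k"
    using t central_binomial_sq_le[of k] power_times_one_minus_le[OF t, of "2 * k"]
    by (intro divide_right_mono mult_mono) auto
  finally show "(\<bar>\<beta>\<bar> * (real (2 * k choose k) * ((1 - \<beta>\<^sup>2) / 4) ^ k))\<^sup>2 \<le> (1 / (2 * real k + 1))\<^sup>2"
    unfolding t_def[symmetric] by (simp add: power_divide divide_simps)
qed simp

text \<open>A walk of n steps, up with weight a and down with weight b. Exponents are raised by 1
  per step, so that up is X^2 and down is constant, and a return to the origin after n steps is read
  off at X^n.\<close>

lemma coeff_walk:
  fixes a b :: real
  shows "coeff ((monom a 2 + [:b:]) ^ n) n = (if even n then real (n choose (n div 2)) * (a * b) ^ (n div 2) else 0)"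
proof -
  have "coeff ((monom a 2 + [:b:]) ^ n) n = (\<Sum>k\<le>n. real (n choose k) * (if 2 * k = n then a ^ k * b ^ (n - k) else 0))"
    unfolding binomial_ring coeff_sum
  proof (rule sum.cong)
    fix k
    have "of_nat (n choose k) * monom a 2 ^ k * [:b:] ^ (n - k)
      = smult (real (n choose k) * b ^ (n - k)) (monom (a ^ k) (2 * k))"
      by (simp add: monom_power poly_const_pow of_nat_poly mult_ac)
    then show "coeff (of_nat (n choose k) * monom a 2 ^ k * [:b:] ^ (n - k)) n
      = real (n choose k) * (if 2 * k = n then a ^ k * b ^ (n - k) else 0)" by simp
  qed simp
  also have "\<dots> = (if even n then real (n choose (n div 2)) * (a * b) ^ (n div 2) else 0)"
  proof (cases "even n")
    case True
    then obtain j where n: "n = 2 * j" by blast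
    have "(\<Sum>k\<le>n. real (n choose k) * (if 2 * k = n then a ^ k * b ^ (n - k) else 0))
      = (\<Sum>k\<in>{j}. real (n choose k) * (if 2 * k = n then a ^ k * b ^ (n - k) else 0))"
      by (rule sum.mono_neutral_right) (auto simp: n)
    then show ?thesis by (simp add: n power_mult_distrib mult_2)
  next
    case False
    then have "2 * k \<noteq> n" for k by auto
    with False show ?thesis by simp
  qed
  finally show ?thesis .
qed

text \<open>The tie probability is the coefficient of \<open>X ^ m\<close> in the \<open>m\<close>-th power of \<open>X\<close> times the
  generating function of the contribution of one observation to the vote.\<close>

lemma expect_tie_eq_coeff:
  assumes "(p, b) \<in> params d" "x \<in> {1..d}"
  shows "expect m d p b (\<lambda>z. of_bool (vote m z x = 0)) =
    coeff (((monom (p x * (1 / 2 + b x / 2)) 2 + [:p x * (1 / 2 - b x / 2):]) + monom (1 - p x) 1) ^ m) m"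
proof -
  define c where "c e = snd e * of_bool (fst e = x)" for e :: "nat \<times> int"
  define F where "F e = monom (wt p b e) (nat (1 + c e))" for e
  have sumF: "(\<Sum>e\<in>examples d. F e)
    = (monom (p x * (1 / 2 + b x / 2)) 2 + [:p x * (1 / 2 - b x / 2):]) + monom (1 - p x) 1"
  proof -
    have "(\<Sum>e\<in>examples d. F e) = (F (x, 1) + F (x, -1)) + (\<Sum>y\<in>{1..d} - {x}. F (y, 1) + F (y, -1))"
      by (rule sum_examples_split) fact
    also have "(\<Sum>y\<in>{1..d} - {x}. F (y, 1) + F (y, -1)) = (\<Sum>y\<in>{1..d} - {x}. monom (p y) 1)"
      by (rule sum.cong) (auto simp: F_def c_def wt_def add_monom field_simps)
    also have "\<dots> = monom (\<Sum>y\<in>{1..d} - {x}. p y) 1"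
      by (rule poly_eqI) (simp add: coeff_sum)
    also have "(\<Sum>y\<in>{1..d} - {x}. p y) = 1 - p x"
      using params_D(4)[OF assms(1)] assms(2) by (simp add: sum_diff1)
    also have "F (x, 1) + F (x, -1) = monom (p x * (1 / 2 + b x / 2)) 2 + [:p x * (1 / 2 - b x / 2):]"
      by (simp add: F_def c_def wt_def monom_0 numeral_2_eq_2)
    finally show ?thesis .
  qed
  have prodF: "coeff (\<Prod>i\<in>{1..m}. F (z i)) m = sample_wt m p b z * of_bool (vote m z x = 0)"
    if z: "z \<in> samples m d" for z
  proof -
    have monoms: "(\<Prod>i\<in>A. F (z i)) = monom (\<Prod>i\<in>A. wt p b (z i)) (\<Sum>i\<in>A. nat (1 + c (z i)))" if "finite A" for A
      using that by (induction A) (auto simp: F_def mult_monom monom_0)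
    have "int (\<Sum>i\<in>{1..m}. nat (1 + c (z i))) = (\<Sum>i\<in>{1..m}. 1 + c (z i))"
    proof (unfold of_nat_sum, rule sum.cong)
      fix i assume "i \<in> {1..m}"
      from z have "z i \<in> examples d" using \<open>i \<in> {1..m}\<close> by (auto simp: samples_def)
      then show "int (nat (1 + c (z i))) = 1 + c (z i)" by (auto simp: examples_def c_def)
    qed simp
    also have "\<dots> = int m + vote m z x" by (simp add: sum.distrib vote_def c_def)
    finally have "(\<Sum>i\<in>{1..m}. nat (1 + c (z i))) = m \<longleftrightarrow> vote m z x = 0" by linarith
    then show ?thesis by (simp add: monoms sample_wt_def)
  qed
  have "expect m d p b (\<lambda>z. of_bool (vote m z x = 0)) = (\<Sum>z\<in>samples m d. coeff (\<Prod>i\<in>{1..m}. F (z i)) m)"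
    unfolding expect_def by (intro sum.cong refl) (simp only: prodF real_scaleR_def)
  also have "\<dots> = coeff ((\<Sum>e\<in>examples d. F e) ^ m) m"
    by (simp only: sum_sample_prod[symmetric] coeff_sum)
  finally show ?thesis unfolding sumF .
qed

text \<open>Expanding by the number n of observations at x leaves a walk of n steps. The resulting
  bound does not involve \<open>p x\<close>, so summing over the points costs only the factor
  d.\<close>

lemma tie_term_le:
  assumes "(p, b) \<in> params d" "x \<in> {1..d}"
  shows "p x * \<bar>b x\<bar> * expect m d p b (\<lambda>z. of_bool (vote m z x = 0)) \<le> 1 / (real m + 1)"
proof -
  let ?q = "p x" and ?\<beta> = "b x"
  define G where "G = monom (?q * (1 / 2 + ?\<beta> / 2)) 2 + [:?q * (1 / 2 - ?\<beta> / 2):]"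
  have q: "0 \<le> ?q" "?q \<le> 1" and \<beta>: "\<bar>?\<beta>\<bar> \<le> 1" using params_D[OF assms(1)] assms(2) by auto
  \<comment> \<open>The weight of a walk of n steps is homogeneous of degree n in
    \<open>p x\<close>, and for odd n a return is impossible.\<close>
  have G: "\<bar>?\<beta>\<bar> * coeff (G ^ n) n \<le> ?q ^ n / (real n + 1)" for n
  proof (cases "even n")
    case True
    then obtain k where n: "n = 2 * k" by blast
    have ab: "?q * (1 / 2 + ?\<beta> / 2) * (?q * (1 / 2 - ?\<beta> / 2)) = ?q\<^sup>2 * ((1 - ?\<beta>\<^sup>2) / 4)"
      by (simp add: field_simps power2_eq_square)
    have "coeff (G ^ n) n = real (2 * k choose k) * (?q\<^sup>2 * ((1 - ?\<beta>\<^sup>2) / 4)) ^ k"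
      unfolding G_def coeff_walk n ab by simp
    then have "\<bar>?\<beta>\<bar> * coeff (G ^ n) n = ?q ^ n * (\<bar>?\<beta>\<bar> * (real (2 * k choose k) * ((1 - ?\<beta>\<^sup>2) / 4) ^ k))"
      by (simp only: power_mult_distrib n power_mult[of "?q"] mult.left_commute)
    also have "\<dots> \<le> ?q ^ n * (1 / (2 * real k + 1))"
      using q by (intro mult_left_mono central_binomial_bias_le \<beta>) auto
    finally show ?thesis by (simp add: n)
  next
    case False
    then show ?thesis using q unfolding G_def coeff_walk by simp
  qed
  have coeff: "coeff ((G + monom (1 - ?q) 1) ^ m) m = (\<Sum>n\<le>m. real (m choose n) * (1 - ?q) ^ (m - n) * coeff (G ^ n) n)"
    unfolding binomial_ring coeff_sum
  proof (rule sum.cong)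
    fix n assume n: "n \<in> {..m}"
    have "of_nat (m choose n) * G ^ n * monom (1 - ?q) 1 ^ (m - n)
      = smult (real (m choose n)) (monom ((1 - ?q) ^ (m - n)) (m - n) * G ^ n)"
      by (simp add: monom_power of_nat_poly mult_ac)
    then show "coeff (of_nat (m choose n) * G ^ n * monom (1 - ?q) 1 ^ (m - n)) m
      = real (m choose n) * (1 - ?q) ^ (m - n) * coeff (G ^ n) n"
      using n by (simp add: coeff_monom_mult)
  qed simp
  have "(real m + 1) * (?q * \<bar>?\<beta>\<bar> * expect m d p b (\<lambda>z. of_bool (vote m z x = 0)))
    = (\<Sum>n\<le>m. (real m + 1) * (?q * (real (m choose n) * (1 - ?q) ^ (m - n) * (\<bar>?\<beta>\<bar> * coeff (G ^ n) n))))"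
    unfolding expect_tie_eq_coeff[OF assms] G_def[symmetric] coeff sum_distrib_left
    by (rule sum.cong) (simp_all add: mult_ac)
  also have "\<dots> \<le> (\<Sum>n\<le>m. (real m + 1) * (?q * (real (m choose n) * (1 - ?q) ^ (m - n) * (?q ^ n / (real n + 1)))))"
    using q by (intro sum_mono mult_left_mono G mult_nonneg_nonneg) auto
  \<comment> \<open>The factor (m + 1) / (n + 1) turns \<open>m choose n\<close> into
    \<open>Suc m choose Suc n\<close>: the sum is the probability of at least one success in m + 1
    trials.\<close>
  also have "\<dots> = (\<Sum>n\<le>m. real (Suc m choose Suc n) * ?q ^ Suc n * (1 - ?q) ^ (Suc m - Suc n))"
  proof (rule sum.cong)
    fix n
    have "real (Suc n) * real (Suc m choose Suc n) = real (Suc m) * real (m choose n)"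
      by (metis Suc_times_binomial of_nat_mult)
    then have "real (Suc m choose Suc n) = (real m + 1) * real (m choose n) / (real n + 1)"
      by (simp add: field_simps)
    then show "(real m + 1) * (?q * (real (m choose n) * (1 - ?q) ^ (m - n) * (?q ^ n / (real n + 1))))
      = real (Suc m choose Suc n) * ?q ^ Suc n * (1 - ?q) ^ (Suc m - Suc n)"
      by (simp only: diff_Suc_Suc power_Suc times_divide_eq_right times_divide_eq_left mult_ac)
  qed simp
  also have "\<dots> \<le> (1 - ?q) ^ Suc m + (\<Sum>n\<le>m. real (Suc m choose Suc n) * ?q ^ Suc n * (1 - ?q) ^ (Suc m - Suc n))"
    using zero_le_power[of "1 - ?q" "Suc m"] q by linarith
  also have "\<dots> = (\<Sum>n\<le>Suc m. real (Suc m choose n) * ?q ^ n * (1 - ?q) ^ (Suc m - n))"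
    unfolding sum.atMost_Suc_shift[of _ m] by (simp only: binomial_n_0 power_0 diff_zero of_nat_1 mult_1 mult_1_right)
  also have "\<dots> = (?q + (1 - ?q)) ^ Suc m" by (rule binomial_ring[symmetric])
  also have "\<dots> = 1" by simp
  finally have "(real m + 1) * (?q * \<bar>?\<beta>\<bar> * expect m d p b (\<lambda>z. of_bool (vote m z x = 0))) \<le> 1" .
  moreover have "0 < real m + 1" by simp
  ultimately show ?thesis by (simp only: pos_le_divide_eq mult.commute)
qed

lemma params_nonempty: "d \<ge> 1 \<Longrightarrow> params d \<noteq> {}"
proof -
  assume "d \<ge> 1"
  then have "(\<lambda>x. of_bool (x = 1), \<lambda>_. 0) \<in> params d" by (auto simp: params_def of_bool_def)
  then show ?thesis by blast
qed

lemma tie_bound_le: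
  assumes "d \<ge> 1"
  shows "tie_bound m d \<le> real d / (2 * (real m + 1))"
proof -
  have "(SUP (p, b)\<in>params d. \<Sum>x=1..d. p x * \<bar>b x\<bar> * tie_prob m d p b x) \<le> real d / (real m + 1)"
  proof (rule cSUP_least[OF params_nonempty[OF assms]], clarify)
    fix p b assume par: "(p, b) \<in> params d"
    have "(\<Sum>x=1..d. p x * \<bar>b x\<bar> * tie_prob m d p b x) \<le> (\<Sum>x=1..d. 1 / (real m + 1))"
      unfolding tie_prob_eq[OF par] by (intro sum_mono tie_term_le par)
    then show "(\<Sum>x=1..d. p x * \<bar>b x\<bar> * tie_prob m d p b x) \<le> real d / (real m + 1)" by simp
  qed
  then have "tie_bound m d \<le> 1 / 2 * (real d / (real m + 1))"
    unfolding tie_bound_def by (rule mult_left_mono) simp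
  also have "\<dots> = real d / (2 * (real m + 1))" by simp
  finally show ?thesis .
qed

section \<open>The constant\<close>

lemma erf_has_derivative: "(erf has_real_derivative 2 / sqrt pi * exp (- (u\<^sup>2))) (at u)"
proof -
  \<comment> \<open>The interval contains 0 and has u in its interior, so the derivative within it
    is the full derivative.\<close>
  let ?A = "{- \<bar>u\<bar> - 1..\<bar>u\<bar> + 1}"
  have cont: "continuous_on ?A (\<lambda>t. exp (- (t\<^sup>2)))" by (intro continuous_intros)
  have "((\<lambda>u. LBINT t=0..u. exp (- (t\<^sup>2))) has_vector_derivative exp (- (u\<^sup>2))) (at u within ?A)"
    using interval_integral_FTC2[OF _ _ cont, of 0 u] by (simp add: zero_ereal_def)
  moreover have "at u within ?A = at u" by (rule at_within_interior) auto
  ultimately have "((\<lambda>u. LBINT t=0..u. exp (- (t\<^sup>2))) has_real_derivative exp (- (u\<^sup>2))) (at u)"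
    by (simp add: has_real_derivative_iff_has_vector_derivative)
  then show ?thesis unfolding erf_def[abs_def] by (rule DERIV_cmult)
qed

lemma erf_0 [simp]: "erf 0 = 0"
  by (simp add: erf_def zero_ereal_def[symmetric])

lemma erf_minus: "erf (- u) = - erf u"
proof -
  have "((\<lambda>u. erf u + erf (- u)) has_real_derivative 0) (at u)" for u
    by (rule derivative_eq_intros DERIV_chain2[OF erf_has_derivative] erf_has_derivative refl | simp)+
  then have "erf u + erf (- u) = erf 0 + erf (- 0)"
    by (intro DERIV_isconst_all[where f = "\<lambda>u. erf u + erf (- u)"]) auto
  then show ?thesis by simp
qed

lemma half_erf_has_derivative:
  "((\<lambda>x. erf (x / sqrt 2) / 2) has_real_derivative std_normal_density x) (at x)"
proof -
  have "((\<lambda>x. erf (x / sqrt 2) / 2) has_real_derivative (2 / sqrt pi * exp (- ((x / sqrt 2)\<^sup>2)) * (1 / sqrt 2)) / 2) (at x)"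
    by (intro DERIV_cdivide DERIV_chain2[OF erf_has_derivative]) (auto intro!: derivative_eq_intros)
  then show ?thesis by (simp add: std_normal_density_def power_divide real_sqrt_mult mult_ac)
qed

interpretation std_normal: real_distribution std_normal_distribution
  by (rule real_dist_normal_dist)

lemma std_normal_Icc:
  assumes "a \<le> b"
  shows "measure std_normal_distribution {a..b} = erf (b / sqrt 2) / 2 - erf (a / sqrt 2) / 2"
proof -
  have "emeasure std_normal_distribution {a..b} = (\<integral>\<^sup>+x. ennreal (std_normal_density x) * indicator {a..b} x \<partial>lborel)"
    by (rule emeasure_density) auto
  also have "\<dots> = ennreal (erf (b / sqrt 2) / 2 - erf (a / sqrt 2) / 2)"
    by (rule nn_integral_FTC_Icc) (use assms half_erf_has_derivative in auto)
  moreover have "erf (a / sqrt 2) / 2 \<le> erf (b / sqrt 2) / 2"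
    by (rule DERIV_nonneg_imp_nondecreasing[OF assms])
       (use half_erf_has_derivative normal_density_nonneg in blast)
  ultimately show ?thesis by (simp add: measure_def)
qed

lemma std_normal_singleton: "measure std_normal_distribution {x} = 0"
  using std_normal_Icc[of x x] by simp

lemma isCont_std_normal_cdf: "isCont (cdf std_normal_distribution) x"
  by (simp add: std_normal.isCont_cdf std_normal_singleton)

lemma std_normal_cdf_diff:
  assumes "a \<le> b"
  shows "cdf std_normal_distribution b - cdf std_normal_distribution a = erf (b / sqrt 2) / 2 - erf (a / sqrt 2) / 2"
proof (cases "a = b")
  case False
  then have "a < b" using assms by simp
  have "measure std_normal_distribution ({a} \<union> {a<..b})
    = measure std_normal_distribution {a} + measure std_normal_distribution {a<..b}"
    by (rule std_normal.finite_measure_Union) auto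
  moreover have "{a} \<union> {a<..b} = {a..b}" using \<open>a < b\<close> by auto
  ultimately show ?thesis
    using std_normal.cdf_diff_eq[OF \<open>a < b\<close>] std_normal_singleton std_normal_Icc[OF assms] by simp
qed simp

text \<open>Fixes the constant of integration: increments of the distribution function F are those
  of an odd function, so F(x) + F(-x) is constant for x \<ge> 0, and its limit at infinity is
  1.\<close>

lemma std_normal_cdf_0: "cdf std_normal_distribution 0 = 1 / 2"
proof -
  let ?F = "cdf std_normal_distribution"
  have "((\<lambda>x. ?F x) \<longlongrightarrow> 1) at_top" by (rule std_normal.cdf_lim_at_top_prob)
  moreover have "((\<lambda>x. ?F (- x)) \<longlongrightarrow> 0) at_top"
    by (rule filterlim_compose[OF std_normal.cdf_lim_at_bot filterlim_uminus_at_bot_at_top])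
  ultimately have lim: "((\<lambda>x. ?F x + ?F (- x)) \<longlongrightarrow> 1 + 0) at_top" by (rule tendsto_add)
  have "\<forall>\<^sub>F x in at_top. ?F x + ?F (- x) = 2 * ?F 0"
    using eventually_ge_at_top[of 0]
  proof eventually_elim
    case (elim x)
    then show ?case using std_normal_cdf_diff[of 0 x] std_normal_cdf_diff[of "- x" 0]
      by (simp add: erf_minus)
  qed
  with lim have "((\<lambda>x::real. 2 * ?F 0) \<longlongrightarrow> 1 + 0) at_top" by (rule Lim_transform_eventually)
  then have "2 * ?F 0 = 1 + 0" by (rule tendsto_unique[OF trivial_limit_at_top_linorder tendsto_const])
  then show ?thesis by simp
qed

lemma std_normal_cdf_eq: "cdf std_normal_distribution x = (1 + erf (x / sqrt 2)) / 2"
proof (cases "0 \<le> x")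
  case True
  from std_normal_cdf_diff[OF this] show ?thesis by (simp add: std_normal_cdf_0 field_simps)
next
  case False
  then have "x \<le> 0" by simp
  from std_normal_cdf_diff[OF this] show ?thesis by (simp add: std_normal_cdf_0 field_simps)
qed

lemma c_infty_fun_eq: "c_infty_fun z = z * cdf std_normal_distribution (- z)"
  by (simp add: c_infty_fun_def std_normal_cdf_eq erf_minus)

section \<open>The shape of the function that is maximized\<close>

definition upper_tail :: "real \<Rightarrow> real" where
  "upper_tail z = cdf std_normal_distribution (- z)"

lemma upper_tail_0: "upper_tail 0 = 1 / 2"
  by (simp add: upper_tail_def std_normal_cdf_0)

lemma upper_tail_has_derivative: "(upper_tail has_real_derivative - std_normal_density z) (at z)"
proof -
  have "upper_tail = (\<lambda>z. 1 / 2 - erf (z / sqrt 2) / 2)"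
    by (simp add: fun_eq_iff upper_tail_def std_normal_cdf_eq erf_minus field_simps)
  moreover have "((\<lambda>z. 1 / 2 - erf (z / sqrt 2) / 2) has_real_derivative 0 - std_normal_density z) (at z)"
    by (intro DERIV_diff DERIV_const half_erf_has_derivative)
  ultimately show ?thesis by simp
qed

lemma c_infty_fun_upper_tail: "c_infty_fun z = z * upper_tail z"
  by (simp add: c_infty_fun_eq upper_tail_def)

lemma std_normal_density_has_derivative:
  "(std_normal_density has_real_derivative - z * std_normal_density z) (at z)"
proof -
  have "((\<lambda>x. 1 / sqrt (2 * pi) * exp (- x\<^sup>2 / 2)) has_real_derivative
      1 / sqrt (2 * pi) * (exp (- z\<^sup>2 / 2) * - z)) (at z)"
    by (intro DERIV_cmult DERIV_fun_exp) (auto intro!: derivative_eq_intros)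
  then show ?thesis by (simp add: std_normal_density_def[abs_def] mult_ac)
qed

text \<open>Its own derivative is (z^2 - 2) times the normal density. The recurring bound
  \<open>sqrt 2\<close> is thus the inflection point of \<open>c_infty_fun\<close>.\<close>

definition c_infty_deriv :: "real \<Rightarrow> real" where
  "c_infty_deriv z = upper_tail z - z * std_normal_density z"

lemma c_infty_fun_has_derivative: "(c_infty_fun has_real_derivative c_infty_deriv z) (at z)"
  unfolding c_infty_fun_upper_tail[abs_def] c_infty_deriv_def
  by (auto intro!: derivative_eq_intros upper_tail_has_derivative)

lemma c_infty_deriv_has_derivative:
  "(c_infty_deriv has_real_derivative (z\<^sup>2 - 2) * std_normal_density z) (at z)"
  unfolding c_infty_deriv_def[abs_def]
  by (auto intro!: derivative_eq_intros upper_tail_has_derivative std_normal_density_has_derivative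
      simp: algebra_simps power2_eq_square)

lemma sqrt2_square_le: "0 \<le> z \<Longrightarrow> z \<le> sqrt 2 \<Longrightarrow> z\<^sup>2 \<le> 2"
  by (metis real_sqrt_pow2 power_mono zero_le_numeral)

lemma c_infty_deriv_antimono:
  assumes "0 \<le> y" "y \<le> z" "z \<le> sqrt 2"
  shows "c_infty_deriv z \<le> c_infty_deriv y"
proof (rule DERIV_nonpos_imp_nonincreasing[OF assms(2)])
  fix t assume "y \<le> t" "t \<le> z"
  then have "t\<^sup>2 \<le> 2" using assms by (intro sqrt2_square_le) auto
  then show "\<exists>y. (c_infty_deriv has_real_derivative y) (at t) \<and> y \<le> 0"
    using c_infty_deriv_has_derivative[of t] by (intro exI[of _ "(t\<^sup>2 - 2) * std_normal_density t"]) (auto simp: mult_le_0_iff)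
qed

lemma c_infty_deriv_mono:
  assumes "sqrt 2 \<le> y" "y \<le> z"
  shows "c_infty_deriv y \<le> c_infty_deriv z"
proof (rule DERIV_nonneg_imp_nondecreasing[OF assms(2)])
  fix t assume "y \<le> t" "t \<le> z"
  then have "sqrt 2 \<le> t" using assms by simp
  then have "2 \<le> t\<^sup>2" using power_mono[of "sqrt 2" t 2] by simp
  then show "\<exists>y. (c_infty_deriv has_real_derivative y) (at t) \<and> 0 \<le> y"
    using c_infty_deriv_has_derivative[of t] by (intro exI[of _ "(t\<^sup>2 - 2) * std_normal_density t"]) auto
qed

lemma c_infty_deriv_lim: "(c_infty_deriv \<longlongrightarrow> 0) at_top"
proof -
  have "(upper_tail \<longlongrightarrow> 0) at_top"
    unfolding upper_tail_def
    by (rule filterlim_compose[OF std_normal.cdf_lim_at_bot filterlim_uminus_at_bot_at_top])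
  moreover have "((\<lambda>z. z * std_normal_density z) \<longlongrightarrow> 0) at_top"
    unfolding std_normal_density_def by real_asymp
  ultimately show ?thesis
    unfolding c_infty_deriv_def[abs_def] using tendsto_diff by fastforce
qed

text \<open>Beyond the inflection point the derivative increases towards its limit 0, so it stays
  below 0. This confines the search for the maximum to a compact interval.\<close>

lemma c_infty_deriv_nonpos:
  assumes "sqrt 2 \<le> z"
  shows "c_infty_deriv z \<le> 0"
proof (rule tendsto_lowerbound[OF c_infty_deriv_lim])
  show "\<forall>\<^sub>F x in at_top. c_infty_deriv z \<le> c_infty_deriv x"
    using eventually_ge_at_top[of z] by eventually_elim (rule c_infty_deriv_mono[OF assms])
qed simp

lemma c_infty_fun_beyond:
  assumes "sqrt 2 \<le> z"
  shows "c_infty_fun z \<le> c_infty_fun (sqrt 2)"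
  by (rule DERIV_nonpos_imp_nonincreasing[OF assms])
     (use c_infty_fun_has_derivative c_infty_deriv_nonpos in blast)

text \<open>\<open>c_infty_fun\<close> is concave on \<open>[0, sqrt 2]\<close>, so it lies below its tangents there.\<close>

lemma c_infty_fun_le_tangent:
  assumes "0 \<le> y" "y \<le> sqrt 2" "0 \<le> z" "z \<le> sqrt 2"
  shows "c_infty_fun z \<le> c_infty_fun y + c_infty_deriv y * (z - y)"
proof (cases z y rule: linorder_cases)
  case less
  obtain t where t: "z < t" "t < y" "c_infty_fun y - c_infty_fun z = (y - z) * c_infty_deriv t"
    using MVT2[OF less, of c_infty_fun c_infty_deriv] c_infty_fun_has_derivative by auto
  have "c_infty_deriv y \<le> c_infty_deriv t" using t assms by (intro c_infty_deriv_antimono) auto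
  then have "(y - z) * c_infty_deriv y \<le> (y - z) * c_infty_deriv t" using less by (intro mult_left_mono) auto
  with t(3) show ?thesis by (simp add: algebra_simps)
next
  case greater
  obtain t where t: "y < t" "t < z" "c_infty_fun z - c_infty_fun y = (z - y) * c_infty_deriv t"
    using MVT2[OF greater, of c_infty_fun c_infty_deriv] c_infty_fun_has_derivative by auto
  have "c_infty_deriv t \<le> c_infty_deriv y" using t assms by (intro c_infty_deriv_antimono) auto
  then have "(z - y) * c_infty_deriv t \<le> (z - y) * c_infty_deriv y" using greater by (intro mult_left_mono) auto
  with t(3) show ?thesis by (simp add: algebra_simps)
qed simp

text \<open>The Lagrange remainder of order 6 is nonnegative because the power is even, and that of
  order 7 is nonpositive for \<open>s \<ge> 0\<close>.\<close>

lemma exp_minus_bounds: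
  fixes s :: real
  shows "1 - s + s\<^sup>2 / 2 - s ^ 3 / 6 + s ^ 4 / 24 - s ^ 5 / 120 \<le> exp (- s)"
    and "0 \<le> s \<Longrightarrow> exp (- s) \<le> 1 - s + s\<^sup>2 / 2 - s ^ 3 / 6 + s ^ 4 / 24 - s ^ 5 / 120 + s ^ 6 / 720"
proof -
  obtain t where "exp (- s) = (\<Sum>m<6. (- s) ^ m / fact m) + exp t / fact 6 * (- s) ^ 6"
    using Maclaurin_exp_le[of "- s" 6] by blast
  then have "exp (- s) = (1 - s + s\<^sup>2 / 2 - s ^ 3 / 6 + s ^ 4 / 24 - s ^ 5 / 120) + exp t / fact 6 * s ^ 6"
    by (simp add: numeral_eq_Suc fact_reduce)
  moreover have "0 \<le> exp t / fact 6 * s ^ 6" by simp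
  ultimately show "1 - s + s\<^sup>2 / 2 - s ^ 3 / 6 + s ^ 4 / 24 - s ^ 5 / 120 \<le> exp (- s)"
    by linarith
  assume s: "0 \<le> s"
  obtain t where "exp (- s) = (\<Sum>m<7. (- s) ^ m / fact m) + exp t / fact 7 * (- s) ^ 7"
    using Maclaurin_exp_le[of "- s" 7] by blast
  then have "exp (- s) = (1 - s + s\<^sup>2 / 2 - s ^ 3 / 6 + s ^ 4 / 24 - s ^ 5 / 120 + s ^ 6 / 720) - exp t / fact 7 * s ^ 7"
    by (simp add: numeral_eq_Suc fact_reduce)
  moreover have "0 \<le> exp t / fact 7 * s ^ 7" using s by simp
  ultimately show "exp (- s) \<le> 1 - s + s\<^sup>2 / 2 - s ^ 3 / 6 + s ^ 4 / 24 - s ^ 5 / 120 + s ^ 6 / 720"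
    by linarith
qed

text \<open>P integrates the Taylor polynomial of exp(-t^2/2) from 0 to z, whence for instance 42240
  = 11 * 2^5 * 5! and 599040 = 13 * 2^6 * 6!. The bounds agree at 0 and follow by comparing
  derivatives.\<close>

lemma upper_tail_bounds:
  fixes z :: real
  assumes "0 \<le> z"
  defines "P \<equiv> z - z ^ 3 / 6 + z ^ 5 / 40 - z ^ 7 / 336 + z ^ 9 / 3456 - z ^ 11 / 42240"
  shows "upper_tail z \<le> 1 / 2 - 1 / sqrt (2 * pi) * P"
    and "1 / 2 - 1 / sqrt (2 * pi) * (P + z ^ 13 / 599040) \<le> upper_tail z"
proof -
  define r where "r = 1 / sqrt (2 * pi)"
  have r: "0 \<le> r" by (simp add: r_def)
  have dens: "std_normal_density t = r * exp (- (t\<^sup>2 / 2))" for t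
    by (simp add: std_normal_density_def r_def)
  define p where "p t = 1 - t\<^sup>2 / 2 + t ^ 4 / 8 - t ^ 6 / 48 + t ^ 8 / 384 - t ^ 10 / 3840" for t :: real
  have p: "p t \<le> exp (- (t\<^sup>2 / 2))" "exp (- (t\<^sup>2 / 2)) \<le> p t + t ^ 12 / 46080" for t
    using exp_minus_bounds[of "t\<^sup>2 / 2"] by (simp_all add: p_def power_divide flip: power_mult)
  let ?P = "\<lambda>z. z - z ^ 3 / 6 + z ^ 5 / 40 - z ^ 7 / 336 + z ^ 9 / 3456 - z ^ 11 / 42240 :: real"
  have dP: "(?P has_real_derivative p t) (at t)" for t
    unfolding p_def by (auto intro!: derivative_eq_intros)
  have d1: "((\<lambda>z. upper_tail z - (1 / 2 - r * ?P z)) has_real_derivative - (r * exp (- (t\<^sup>2 / 2))) - (0 - r * p t)) (at t)" for t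
    unfolding dens[symmetric] by (intro DERIV_diff upper_tail_has_derivative DERIV_const DERIV_cmult dP)
  have "upper_tail z - (1 / 2 - r * ?P z) \<le> upper_tail 0 - (1 / 2 - r * ?P 0)"
  proof (rule DERIV_nonpos_imp_nonincreasing[OF assms(1)])
    fix t
    show "\<exists>y. ((\<lambda>z. upper_tail z - (1 / 2 - r * ?P z)) has_real_derivative y) (at t) \<and> y \<le> 0"
      by (rule exI, rule conjI[OF d1]) (use mult_left_mono[OF p(1) r] in simp)
  qed
  then show "upper_tail z \<le> 1 / 2 - 1 / sqrt (2 * pi) * P" by (simp add: r_def P_def upper_tail_0)
  have dP2: "((\<lambda>z. ?P z + z ^ 13 / 599040) has_real_derivative (p t + t ^ 12 / 46080)) (at t)" for t
    by (rule DERIV_add[OF dP]) (auto intro!: derivative_eq_intros)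
  have d2: "((\<lambda>z. upper_tail z - (1 / 2 - r * (?P z + z ^ 13 / 599040))) has_real_derivative
      - (r * exp (- (t\<^sup>2 / 2))) - (0 - r * (p t + t ^ 12 / 46080))) (at t)" for t
    unfolding dens[symmetric] by (intro DERIV_diff upper_tail_has_derivative DERIV_const DERIV_cmult dP2)
  have "upper_tail 0 - (1 / 2 - r * (?P 0 + 0 ^ 13 / 599040)) \<le> upper_tail z - (1 / 2 - r * (?P z + z ^ 13 / 599040))"
  proof (rule DERIV_nonneg_imp_nondecreasing[OF assms(1)])
    fix t
    show "\<exists>y. ((\<lambda>z. upper_tail z - (1 / 2 - r * (?P z + z ^ 13 / 599040))) has_real_derivative y) (at t) \<and> 0 \<le> y"
      by (rule exI, rule conjI[OF d2]) (use mult_left_mono[OF p(2) r] in simp)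
  qed
  then show "1 / 2 - 1 / sqrt (2 * pi) * (P + z ^ 13 / 599040) \<le> upper_tail z"
    by (simp add: r_def P_def upper_tail_0)
qed

lemma inverse_sqrt_2pi_bounds: "0.3989422 \<le> 1 / sqrt (2 * pi)" "1 / sqrt (2 * pi) \<le> 0.3989423"
proof -
  have "sqrt (2 * pi) \<le> 1 / 0.3989422"
    by (rule real_le_lsqrt) (use pi_approx in \<open>auto simp: power2_eq_square\<close>)
  moreover have "1 / 0.3989423 \<le> sqrt (2 * pi)"
    by (rule real_le_rsqrt) (use pi_approx in \<open>auto simp: power2_eq_square\<close>)
  moreover have "0 < sqrt (2 * pi)" by simp
  ultimately show "0.3989422 \<le> 1 / sqrt (2 * pi)" "1 / sqrt (2 * pi) \<le> 0.3989423"
    by (auto simp: field_simps)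
qed

text \<open>The point 0.7518 approximates the maximizer, the zero of \<open>c_infty_deriv\<close>.
  The value there bounds the maximum from below, and the nearly horizontal tangent bounds it from
  above.\<close>

lemma c_infty_fun_near_max:
  "0.16997 \<le> c_infty_fun 0.7518" "c_infty_fun 0.7518 \<le> 0.169973" "\<bar>c_infty_deriv 0.7518\<bar> \<le> 0.000006"
proof -
  define r where "r = 1 / sqrt (2 * pi)"
  define P :: real where "P = 0.7518 - 0.7518 ^ 3 / 6 + 0.7518 ^ 5 / 40 - 0.7518 ^ 7 / 336 + 0.7518 ^ 9 / 3456 - 0.7518 ^ 11 / 42240"
  have r: "0.3989422 \<le> r" "r \<le> 0.3989423" unfolding r_def by (rule inverse_sqrt_2pi_bounds)+
  have P: "0.686601 \<le> P" "P + 0.7518 ^ 13 / 599040 \<le> 0.686602"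
    unfolding P_def by (simp_all add: power_divide field_simps)
  have "upper_tail 0.7518 \<le> 1 / 2 - r * P" "1 / 2 - r * (P + 0.7518 ^ 13 / 599040) \<le> upper_tail 0.7518"
    using upper_tail_bounds[of "0.7518"] by (simp_all add: P_def r_def)
  moreover have "0.3989422 * 0.686601 \<le> r * P" using r P by (intro mult_mono) auto
  moreover have "r * (P + 0.7518 ^ 13 / 599040) \<le> 0.3989423 * 0.686602" using r P by (intro mult_mono) auto
  ultimately have ut: "0.226085 \<le> upper_tail 0.7518" "upper_tail 0.7518 \<le> 0.226086"
    by simp_all
  show "0.16997 \<le> c_infty_fun 0.7518" "c_infty_fun 0.7518 \<le> 0.169973"
    unfolding c_infty_fun_upper_tail using ut by simp_all
  define E :: real where "E = exp (- (0.7518\<^sup>2 / 2))"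
  have E: "0.753819 \<le> E" "E \<le> 0.753821"
    using exp_minus_bounds[of "0.7518\<^sup>2 / 2"] unfolding E_def by (simp_all add: power_divide)
  have "std_normal_density 0.7518 = r * E" by (simp add: std_normal_density_def r_def E_def)
  moreover have "0.3989422 * 0.753819 \<le> r * E" using r E by (intro mult_mono) auto
  moreover have "r * E \<le> 0.3989423 * 0.753821" using r E by (intro mult_mono) auto
  ultimately have "0.3007302 \<le> std_normal_density 0.7518" "std_normal_density 0.7518 \<le> 0.3007311"
    by simp_all
  then show "\<bar>c_infty_deriv 0.7518\<bar> \<le> 0.000006"
    unfolding c_infty_deriv_def abs_le_iff using ut by simp
qed

lemma c_infty_fun_less:
  assumes "0 \<le> z"
  shows "c_infty_fun z < 0.16998"
proof -
  have s2: "1.41 \<le> sqrt 2" "sqrt 2 \<le> 1.42"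
    by (rule real_le_rsqrt real_le_lsqrt; simp add: power2_eq_square)+
  have small: "c_infty_fun y < 0.16998" if "0 \<le> y" "y \<le> sqrt 2" for y
  proof -
    have "y \<le> 1.42" using that(2) s2(2) by (rule order_trans)
    then have y: "\<bar>y - 0.7518\<bar> \<le> 0.76" unfolding abs_le_iff using that(1) by simp
    have "c_infty_fun y \<le> c_infty_fun 0.7518 + c_infty_deriv 0.7518 * (y - 0.7518)"
      using that s2 by (intro c_infty_fun_le_tangent) auto
    also have "c_infty_deriv 0.7518 * (y - 0.7518) \<le> \<bar>c_infty_deriv 0.7518\<bar> * \<bar>y - 0.7518\<bar>"
      by (metis abs_ge_self abs_mult)
    \<comment> \<open>The distance bound 0.76 covers both 0.7518 and 1.42 - 0.7518. The product is
      below 0.000005, which fits between 0.169973 and 0.16998.\<close>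
    also have "\<dots> \<le> 0.000006 * 0.76"
      using y c_infty_fun_near_max(3) by (intro mult_mono) auto
    finally show ?thesis using c_infty_fun_near_max(2) by simp
  qed
  show ?thesis
  proof (cases "z \<le> sqrt 2")
    case False
    then show ?thesis using c_infty_fun_beyond[of z] small[of "sqrt 2"] by simp
  qed (use assms small in simp)
qed

text \<open>The maximum over the compact interval from 0 to \<open>sqrt 2\<close> is global by
  monotonicity beyond it. The closed endpoint 0 is excluded as maximizer because the value there is
  0.\<close>

lemma c_infty_attained: "\<exists>z>0. c_infty_fun z = c_infty \<and> (\<forall>y>0. c_infty_fun y \<le> c_infty)"
proof -
  have "continuous_on {0..sqrt 2} c_infty_fun"
    using c_infty_fun_has_derivative by (meson DERIV_continuous_on has_field_derivative_at_within)
  then obtain z where z: "z \<in> {0..sqrt 2}" "\<And>y. y \<in> {0..sqrt 2} \<Longrightarrow> c_infty_fun y \<le> c_infty_fun z"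
    using continuous_attains_sup[of "{0..sqrt 2}" c_infty_fun] by auto
  have max: "c_infty_fun y \<le> c_infty_fun z" if "0 < y" for y
    using that z(2)[of y] z(2)[of "sqrt 2"] c_infty_fun_beyond[of y] by fastforce
  have "0 < c_infty_fun z" using max[of "0.7518"] c_infty_fun_near_max(1) by simp
  then have "z \<noteq> 0" by (auto simp: c_infty_fun_def)
  with z have z0: "0 < z" by simp
  have "c_infty = c_infty_fun z"
    unfolding c_infty_def by (rule Greatest_equality) (use z0 max in auto)
  with z0 max show ?thesis by auto
qed

lemma c_infty_bounds: "0.16997 \<le> c_infty" "c_infty < 0.16998"
proof -
  obtain z where z: "0 < z" "c_infty_fun z = c_infty" "\<And>y. 0 < y \<Longrightarrow> c_infty_fun y \<le> c_infty"
    using c_infty_attained by blast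
  show "0.16997 \<le> c_infty" using c_infty_fun_near_max(1) z(3)[of "0.7518"] by simp
  show "c_infty < 0.16998" using c_infty_fun_less[of z] z(1,2) by simp
qed

section \<open>Normal approximation of the vote\<close>

text \<open>Powers \<open>w ^ m\<close> with \<open>norm w \<le> 1\<close> are compared with \<open>exp (w - 1) ^ m\<close>, which also lies
  in the unit disc.\<close>

lemma tendsto_power_exp:
  fixes w :: "nat \<Rightarrow> complex" and m :: "nat \<Rightarrow> nat"
  assumes norm_w: "\<And>k. norm (w k) \<le> 1"
    and m: "filterlim m at_top sequentially"
    and lim: "(\<lambda>k. of_nat (m k) * (w k - 1)) \<longlonglongrightarrow> u"
  shows "(\<lambda>k. w k ^ m k) \<longlonglongrightarrow> exp u"
proof -
  define v where "v k = w k - 1" for k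
  have Re_v: "Re (v k) \<le> 0" for k
    using complex_Re_le_cmod[of "w k"] norm_w[of k] by (simp add: v_def)
  have Re_v2: "\<bar>Re (v k)\<bar> \<le> 2" for k
    using abs_Re_le_cmod[of "v k"] norm_triangle_ineq4[of "w k" 1] norm_w[of k] by (simp add: v_def)
  have m_real: "filterlim (\<lambda>k. real (m k)) at_top sequentially"
    by (rule filterlim_compose[OF filterlim_real_sequentially m])
  have bound: "norm (w k ^ m k - exp (v k) ^ m k) \<le> exp 2 * (norm (of_nat (m k) * v k))\<^sup>2 * inverse (real (m k))" for k
  proof -
    \<comment> \<open>The first-order Taylor remainder is quadratic in \<open>v k\<close>, hence of
      order 1/m^2; m such errors amount to order 1/m.\<close>
    have "norm (w k - exp (v k)) \<le> exp \<bar>Re (v k)\<bar> * (norm (v k))\<^sup>2"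
      using Taylor_exp[of "v k" 1] by (simp add: v_def norm_minus_commute numeral_2_eq_2)
    also have "\<dots> \<le> exp 2 * (norm (v k))\<^sup>2" using Re_v2[of k] by (intro mult_right_mono) auto
    finally have "real (m k) * norm (w k - exp (v k)) \<le> real (m k) * (exp 2 * (norm (v k))\<^sup>2)"
      by (rule mult_left_mono) simp
    moreover have "norm (w k ^ m k - exp (v k) ^ m k) \<le> real (m k) * norm (w k - exp (v k))"
      by (rule norm_power_diff) (use norm_w Re_v in auto)
    moreover have "real (m k) * (exp 2 * (norm (v k))\<^sup>2)
      = exp 2 * (norm (of_nat (m k) * v k))\<^sup>2 * inverse (real (m k))"
      by (cases "m k = 0") (simp_all add: norm_mult power_mult_distrib power2_eq_square)
    ultimately show ?thesis by linarith
  qed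
  have "(\<lambda>k. exp 2 * (norm (of_nat (m k) * v k))\<^sup>2 * inverse (real (m k))) \<longlonglongrightarrow> exp 2 * (norm u)\<^sup>2 * 0"
    using lim unfolding v_def[symmetric]
    by (intro tendsto_mult[OF tendsto_mult[OF tendsto_const tendsto_power[OF tendsto_norm]]] tendsto_inverse_0_at_top m_real)
  then have "(\<lambda>k. w k ^ m k - exp (v k) ^ m k) \<longlonglongrightarrow> 0"
    using Lim_null_comparison[OF always_eventually[OF allI[OF bound]]] by simp
  moreover have "(\<lambda>k. exp (v k) ^ m k) \<longlonglongrightarrow> exp u"
    using tendsto_exp[OF lim] by (simp add: v_def exp_of_nat_mult)
  ultimately have "(\<lambda>k. (w k ^ m k - exp (v k) ^ m k) + exp (v k) ^ m k) \<longlonglongrightarrow> 0 + exp u"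
    by (rule tendsto_add)
  then show ?thesis by simp
qed

text \<open>The characteristic function of one observation's contribution to the vote, written as 1
  plus a perturbation because only m times the perturbation matters in the limit.\<close>

lemma sum_wt_iexp:
  assumes "(p, b) \<in> params d" "x \<in> {1..d}"
  shows "(\<Sum>e\<in>examples d. wt p b e *\<^sub>R iexp (s * real_of_int (snd e * of_bool (fst e = x))))
    = 1 + of_real (p x) * (of_real (cos s - 1) + \<i> * of_real (b x * sin s))"
proof -
  let ?F = "\<lambda>e. wt p b e *\<^sub>R iexp (s * real_of_int (snd e * of_bool (fst e = x)))"
  have "(\<Sum>e\<in>examples d. ?F e) = (?F (x, 1) + ?F (x, -1)) + (\<Sum>y\<in>{1..d} - {x}. ?F (y, 1) + ?F (y, -1))"
    by (rule sum_examples_split) fact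
  also have "(\<Sum>y\<in>{1..d} - {x}. ?F (y, 1) + ?F (y, -1)) = (\<Sum>y\<in>{1..d} - {x}. of_real (p y))"
    by (rule sum.cong) (auto simp: wt_def scaleR_conv_of_real field_simps)
  also have "\<dots> = of_real (1 - p x)"
    using params_D(4)[OF assms(1)] assms(2) by (simp add: sum_diff1 flip: of_real_sum)
  also have "?F (x, 1) + ?F (x, -1) = of_real (p x) * (of_real (cos s) + \<i> * of_real (b x * sin s))"
    by (simp add: wt_def scaleR_conv_of_real complex_eq_iff Re_exp Im_exp algebra_simps)
  finally show ?thesis by (simp add: algebra_simps)
qed

text \<open>A limit theorem for arrays: the law, the domain and the observed point all change with
  k. The drift condition forces the bias to 0, so the variance of the vote is asymptotically m p x,
  and Levy's continuity theorem applies.\<close>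

lemma CLT_vote:
  fixes m d :: "nat \<Rightarrow> nat" and p b :: "nat \<Rightarrow> nat \<Rightarrow> real" and x :: "nat \<Rightarrow> nat" and \<zeta> :: real
  assumes par: "\<And>k. (p k, b k) \<in> params (d k)" and x: "\<And>k. x k \<in> {1..d k}"
    and mean: "filterlim (\<lambda>k. real (m k) * p k (x k)) at_top sequentially"
    and drift: "(\<lambda>k. b k (x k) * sqrt (real (m k) * p k (x k))) \<longlonglongrightarrow> \<zeta>"
  shows "(\<lambda>k. expect (m k) (d k) (p k) (b k) (\<lambda>z. of_bool (vote (m k) z (x k) \<le> 0)))
    \<longlonglongrightarrow> cdf std_normal_distribution (- \<zeta>)"
proof -
  define \<sigma> where "\<sigma> k = sqrt (real (m k) * p k (x k))" for k
  define S where "S k = sample_law (m k) (param_dist (d k) (p k) (b k))" for k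
  \<comment> \<open>Centring at the limit \<zeta> instead of the exact mean moves the event of a
    nonpositive vote to the fixed threshold -\<zeta>, a continuity point of the limit.\<close>
  define X where "X k z = real_of_int (vote (m k) z (x k)) / \<sigma> k - \<zeta>" for k z
  define M where "M k = distr (S k) borel (X k)" for k
  have \<sigma>_top: "filterlim \<sigma> at_top sequentially"
    unfolding \<sigma>_def by (rule filterlim_compose[OF sqrt_at_top mean])
  have q0: "0 \<le> p k (x k)" and q1: "p k (x k) \<le> 1" for k using params_D[OF par] x by blast+
  have m_top: "filterlim m at_top sequentially"
  proof -
    have "filterlim (\<lambda>k. real (m k)) at_top sequentially"
      by (rule filterlim_at_top_mono[OF mean]) (use q1 in \<open>auto intro!: always_eventually simp: mult_left_le\<close>)
    then show ?thesis by (simp add: filterlim_sequentially_iff_filterlim_real)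
  qed
  have meas: "X k \<in> borel_measurable (S k)" for k
    unfolding S_def sample_law_eq[OF par] by simp
  have prob_S: "prob_space (S k)" for k
    unfolding S_def sample_law_def by (rule prob_space_PiM) (rule prob_space_param_dist[OF par])
  have dist: "real_distribution (M k)" for k
    unfolding M_def real_distribution_def real_distribution_axioms_def
    using prob_space.prob_space_distr[OF prob_S meas] by simp
  have char_M: "char (M k) t = iexp (- t * \<zeta>) *
      (1 + of_real (p k (x k)) * (of_real (cos (t / \<sigma> k) - 1) + \<i> * of_real (b k (x k) * sin (t / \<sigma> k)))) ^ m k" for k t
  proof -
    define c where "c e = real_of_int (snd e * of_bool (fst e = x k))" for e :: "nat \<times> int"
    have vote: "real_of_int (vote (m k) z (x k)) = (\<Sum>i\<in>{1..m k}. c (z i))" for z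
      unfolding vote_def c_def by simp
    have "char (M k) t = expect (m k) (d k) (p k) (b k) (\<lambda>z. iexp (t * X k z))"
      unfolding char_def M_def integral_sample_law[OF par, symmetric]
      by (subst integral_distr[OF meas]) (simp_all add: S_def)
    also have "\<dots> = (\<Sum>z\<in>samples (m k) (d k). iexp (- t * \<zeta>) * (\<Prod>i\<in>{1..m k}. wt (p k) (b k) (z i) *\<^sub>R iexp (t / \<sigma> k * c (z i))))"
      unfolding expect_def
    proof (rule sum.cong)
      fix z
      have "iexp (t * X k z) = iexp (- t * \<zeta>) * exp (\<Sum>i\<in>{1..m k}. \<i> * of_real (t / \<sigma> k * c (z i)))"
        unfolding X_def vote exp_add[symmetric] of_real_sum[symmetric] sum_distrib_left[symmetric]
        by (rule arg_cong[of _ _ exp]) (simp add: sum_distrib_left sum_divide_distrib algebra_simps)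
      then show "sample_wt (m k) (p k) (b k) z *\<^sub>R iexp (t * X k z)
        = iexp (- t * \<zeta>) * (\<Prod>i\<in>{1..m k}. wt (p k) (b k) (z i) *\<^sub>R iexp (t / \<sigma> k * c (z i)))"
        by (simp add: sample_wt_def scaleR_conv_of_real prod.distrib exp_sum)
    qed simp
    also have "\<dots> = iexp (- t * \<zeta>) * (\<Sum>e\<in>examples (d k). wt (p k) (b k) e *\<^sub>R iexp (t / \<sigma> k * c e)) ^ m k"
      unfolding sum_distrib_left[symmetric]
        sum_sample_prod[where f = "\<lambda>e. wt (p k) (b k) e *\<^sub>R iexp (t / \<sigma> k * c e)"] ..
    finally show ?thesis unfolding c_def sum_wt_iexp[OF par x] .
  qed
  have norm_le: "norm (1 + of_real (p k (x k)) * (of_real (cos s - 1) + \<i> * of_real (b k (x k) * sin s)) :: complex) \<le> 1" for k s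
  proof -
    have "norm (1 + of_real (p k (x k)) * (of_real (cos s - 1) + \<i> * of_real (b k (x k) * sin s)) :: complex)
      \<le> (\<Sum>e\<in>examples (d k). wt (p k) (b k) e)"
      unfolding sum_wt_iexp[OF par x, symmetric]
      by (rule sum_norm_le) (use wt_nonneg[OF par] in auto)
    then show ?thesis by (simp add: sum_wt[OF par])
  qed
  have char_lim: "(\<lambda>k. char (M k) t) \<longlonglongrightarrow> char std_normal_distribution t" for t
  proof -
    have cos_lim: "(\<lambda>k. (\<sigma> k)\<^sup>2 * (cos (t / \<sigma> k) - 1)) \<longlonglongrightarrow> - (t\<^sup>2) / 2"
    proof (rule filterlim_compose[OF _ \<sigma>_top])
      have "((\<lambda>s. s\<^sup>2 * (cos (t / s) - 1)) \<longlongrightarrow> - (t * t / 2)) at_top" by real_asymp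
      then show "((\<lambda>s. s\<^sup>2 * (cos (t / s) - 1)) \<longlongrightarrow> - (t\<^sup>2) / 2) at_top"
        by (simp add: power2_eq_square)
    qed
    have sin_lim: "(\<lambda>k. \<sigma> k * sin (t / \<sigma> k)) \<longlonglongrightarrow> t"
    proof (rule filterlim_compose[OF _ \<sigma>_top])
      show "((\<lambda>s. s * sin (t / s)) \<longlongrightarrow> t) at_top" by real_asymp
    qed
    have sq: "(\<sigma> k)\<^sup>2 = real (m k) * p k (x k)" for k using q0 by (simp add: \<sigma>_def)
    \<comment> \<open>This is m times the perturbation: the cosine part gives the variance and the
      sine part the drift.\<close>
    have "(\<lambda>k. complex_of_real ((\<sigma> k)\<^sup>2 * (cos (t / \<sigma> k) - 1))
        + \<i> * of_real ((b k (x k) * \<sigma> k) * (\<sigma> k * sin (t / \<sigma> k)))) \<longlonglongrightarrow> of_real (- (t\<^sup>2) / 2) + \<i> * of_real (\<zeta> * t)"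
      using drift unfolding \<sigma>_def[symmetric]
      by (intro tendsto_add[OF tendsto_of_real[OF cos_lim]] tendsto_mult[OF tendsto_const tendsto_of_real] tendsto_mult[OF _ sin_lim])
    also have "(\<lambda>k. complex_of_real ((\<sigma> k)\<^sup>2 * (cos (t / \<sigma> k) - 1))
        + \<i> * of_real ((b k (x k) * \<sigma> k) * (\<sigma> k * sin (t / \<sigma> k))))
      = (\<lambda>k. of_nat (m k) * ((1 + of_real (p k (x k)) * (of_real (cos (t / \<sigma> k) - 1) + \<i> * of_real (b k (x k) * sin (t / \<sigma> k)))) - 1))"
    proof
      fix k
      have "(b k (x k) * \<sigma> k) * (\<sigma> k * sin (t / \<sigma> k)) = (\<sigma> k)\<^sup>2 * (b k (x k) * sin (t / \<sigma> k))"
        by (simp add: power2_eq_square mult_ac)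
      then show "complex_of_real ((\<sigma> k)\<^sup>2 * (cos (t / \<sigma> k) - 1))
        + \<i> * of_real ((b k (x k) * \<sigma> k) * (\<sigma> k * sin (t / \<sigma> k)))
        = of_nat (m k) * ((1 + of_real (p k (x k)) * (of_real (cos (t / \<sigma> k) - 1) + \<i> * of_real (b k (x k) * sin (t / \<sigma> k)))) - 1)"
        unfolding sq by (simp only: of_real_mult of_real_of_nat_eq) (simp add: algebra_simps)
    qed
    finally have "(\<lambda>k. char (M k) t) \<longlonglongrightarrow> iexp (- t * \<zeta>) * exp (of_real (- (t\<^sup>2) / 2) + \<i> * of_real (\<zeta> * t))"
      unfolding char_M by (intro tendsto_mult[OF tendsto_const] tendsto_power_exp[OF norm_le m_top])
    moreover have "iexp (- t * \<zeta>) * exp (of_real (- (t\<^sup>2) / 2) + \<i> * of_real (\<zeta> * t)) = char std_normal_distribution t"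
    proof -
      have "\<i> * of_real (- t * \<zeta>) + (of_real (- (t\<^sup>2) / 2) + \<i> * of_real (\<zeta> * t)) = of_real (- (t\<^sup>2) / 2)"
        by (simp add: mult.commute)
      then show ?thesis by (simp only: char_std_normal_distribution exp_of_real[symmetric] exp_add[symmetric])
    qed
    ultimately show ?thesis by simp
  qed
  have "weak_conv_m M std_normal_distribution"
    by (rule levy_continuity[OF dist std_normal.real_distribution_axioms char_lim])
  then have cdf_lim: "(\<lambda>k. cdf (M k) (- \<zeta>)) \<longlonglongrightarrow> cdf std_normal_distribution (- \<zeta>)"
    unfolding weak_conv_m_def weak_conv_def using isCont_std_normal_cdf by blast
  \<comment> \<open>Dividing by \<sigma> preserves the sign of the vote only when \<sigma> is
    positive, which holds eventually.\<close>
  have "\<forall>\<^sub>F k in sequentially. \<sigma> k > 0" using \<sigma>_top by (simp add: filterlim_at_top_dense)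
  then have "\<forall>\<^sub>F k in sequentially. cdf (M k) (- \<zeta>)
      = expect (m k) (d k) (p k) (b k) (\<lambda>z. of_bool (vote (m k) z (x k) \<le> 0))"
  proof eventually_elim
    case (elim k)
    interpret S: prob_space "S k" by (rule prob_S)
    have "cdf (M k) (- \<zeta>) = measure (S k) (X k -` {..- \<zeta>} \<inter> space (S k))"
      unfolding cdf_def M_def by (rule measure_distr[OF meas]) simp
    also have "\<dots> = (\<integral>z. indicat_real (X k -` {..- \<zeta>} \<inter> space (S k)) z \<partial>S k)"
      using meas by (simp add: measurable_sets)
    also have "\<dots> = expect (m k) (d k) (p k) (b k) (indicat_real (X k -` {..- \<zeta>} \<inter> space (S k)))"
      unfolding S_def by (rule integral_sample_law[OF par])
    also have "\<dots> = expect (m k) (d k) (p k) (b k) (\<lambda>z. of_bool (vote (m k) z (x k) \<le> 0))"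
      using elim by (intro expect_cong)
        (auto simp: S_def sample_law_eq[OF par] space_point_measure X_def indicator_def divide_le_0_iff)
    finally show ?case .
  qed
  with cdf_lim show ?thesis by (rule Lim_transform_eventually)
qed

text \<open>Exponential Markov inequality with base 1 + b x. The optimal base sqrt((1 + b)/(1 - b))
  degenerates at b = 1; this one gives the polynomial factor (1 + (1 - b^2)) / 2 at x and works up
  to b = 1.\<close>

lemma lower_tail_le_exp:
  assumes par: "(p, b) \<in> params d" and x: "x \<in> {1..d}" and b: "0 \<le> b x"
  shows "expect m d p b (\<lambda>z. of_bool (vote m z x \<le> 0)) \<le> exp (- (real m * p x * (b x)\<^sup>2 / 2))"
proof -
  define c where "c e = snd e * of_bool (fst e = x)" for e :: "nat \<times> int"
  define g where "g e = (1 + b x) powr - real_of_int (c e)" for e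
  have base: "0 < 1 + b x" using b by simp
  have sum: "(\<Sum>e\<in>examples d. wt p b e * g e) = 1 - p x * (b x)\<^sup>2 / 2"
  proof -
    let ?F = "\<lambda>e. wt p b e * g e"
    have "(\<Sum>e\<in>examples d. ?F e) = (?F (x, 1) + ?F (x, -1)) + (\<Sum>y\<in>{1..d} - {x}. ?F (y, 1) + ?F (y, -1))"
      by (rule sum_examples_split) fact
    also have "(\<Sum>y\<in>{1..d} - {x}. ?F (y, 1) + ?F (y, -1)) = (\<Sum>y\<in>{1..d} - {x}. p y)"
      by (rule sum.cong) (use base in \<open>auto simp: wt_def g_def c_def field_simps\<close>)
    also have "\<dots> = 1 - p x"
      using params_D(4)[OF par] x by (simp add: sum_diff1)
    also have "?F (x, 1) + ?F (x, -1) = p x * (1 / 2 + (1 - (b x)\<^sup>2) / 2)"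
      using base by (simp add: wt_def g_def c_def powr_minus field_simps power2_eq_square)
    finally show ?thesis by (simp add: field_simps)
  qed
  have "expect m d p b (\<lambda>z. of_bool (vote m z x \<le> 0)) \<le> expect m d p b (\<lambda>z. (1 + b x) powr - real_of_int (vote m z x))"
    by (rule expect_mono[OF par]) (use b in \<open>auto intro!: ge_one_powr_ge_zero\<close>)
  also have "\<dots> = (\<Sum>z\<in>samples m d. \<Prod>i\<in>{1..m}. wt p b (z i) * g (z i))"
    unfolding expect_def
  proof (rule sum.cong)
    fix z
    have "- real_of_int (vote m z x) = (\<Sum>i\<in>{1..m}. - real_of_int (c (z i)))"
      by (simp add: vote_def c_def sum_negf)
    then have "(1 + b x) powr - real_of_int (vote m z x) = (\<Prod>i\<in>{1..m}. g (z i))"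
      using base by (simp add: powr_sum g_def)
    then show "sample_wt m p b z *\<^sub>R (1 + b x) powr - real_of_int (vote m z x) = (\<Prod>i\<in>{1..m}. wt p b (z i) * g (z i))"
      by (simp add: sample_wt_def prod.distrib)
  qed simp
  also have "\<dots> = (1 - p x * (b x)\<^sup>2 / 2) ^ m"
    using sum_sample_prod[where f = "\<lambda>e. wt p b e * g e"] by (simp only: sum)
  also have "\<dots> \<le> exp (- (p x * (b x)\<^sup>2 / 2)) ^ m"
  proof (rule power_mono)
    show "1 - p x * (b x)\<^sup>2 / 2 \<le> exp (- (p x * (b x)\<^sup>2 / 2))"
      using exp_ge_add_one_self[of "- (p x * (b x)\<^sup>2 / 2)"] by simp
    have "p x * (b x)\<^sup>2 \<le> 1"
      using params_D[OF par] x by (intro mult_le_one) (auto simp: abs_square_le_1)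
    then show "0 \<le> 1 - p x * (b x)\<^sup>2 / 2" by simp
  qed
  also have "\<dots> = exp (- (real m * p x * (b x)\<^sup>2 / 2))"
    by (simp add: exp_of_nat_mult[symmetric] mult_ac)
  finally show ?thesis .
qed

text \<open>Crude decay, from \<open>u \<le> exp u\<close>, but enough to keep the drift of any
  counterexample bounded.\<close>

lemma scaled_lower_tail_le:
  fixes m d x :: nat and p b :: "nat \<Rightarrow> real"
  assumes par: "(p, b) \<in> params d" and x: "x \<in> {1..d}" and b: "0 \<le> b x"
  defines "\<zeta> \<equiv> b x * sqrt (real m * p x)"
  assumes pos: "0 < \<zeta>"
  shows "\<zeta> * expect m d p b (\<lambda>z. of_bool (vote m z x \<le> 0)) \<le> 2 / \<zeta>"
proof -
  have "\<zeta>\<^sup>2 = real m * p x * (b x)\<^sup>2"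
    using params_D(1)[OF par x] by (simp add: \<zeta>_def power_mult_distrib mult_ac)
  then have "expect m d p b (\<lambda>z. of_bool (vote m z x \<le> 0)) \<le> exp (- (\<zeta>\<^sup>2 / 2))"
    using lower_tail_le_exp[of p b d x m, OF par x b] by (simp only:)
  also have "\<dots> = 1 / exp (\<zeta>\<^sup>2 / 2)" by (simp add: exp_minus inverse_eq_divide)
  also have "\<dots> \<le> 1 / (\<zeta>\<^sup>2 / 2)"
  proof (rule divide_left_mono)
    show "\<zeta>\<^sup>2 / 2 \<le> exp (\<zeta>\<^sup>2 / 2)" using exp_ge_add_one_self[of "\<zeta>\<^sup>2 / 2"] by linarith
  qed (use pos in auto)
  finally have "\<zeta> * expect m d p b (\<lambda>z. of_bool (vote m z x \<le> 0)) \<le> \<zeta> * (1 / (\<zeta>\<^sup>2 / 2))"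
    using pos by (intro mult_left_mono) auto
  also have "\<dots> = 2 / \<zeta>" using pos by (simp add: power2_eq_square)
  finally show ?thesis .
qed

text \<open>Adds the endpoint 0, which a convergent sequence of positive drifts may reach.\<close>

lemma c_infty_fun_limit_le:
  assumes "\<And>y. 0 < y \<Longrightarrow> c_infty_fun y \<le> C" "0 \<le> C" "0 \<le> z"
  shows "c_infty_fun z \<le> C"
  using assms by (cases "z = 0") (auto simp: c_infty_fun_def)

text \<open>A sequence of counterexamples would have bounded drift by \<open>scaled_lower_tail_le\<close>, and along a
  subsequence with convergent drift the central limit theorem bounds the limit.\<close>

lemma uniform_tail_bound:
  assumes C: "\<And>y. 0 < y \<Longrightarrow> c_infty_fun y \<le> C" "0 \<le> C" and "0 < \<epsilon>"
  shows "\<exists>K>0. \<forall>m d p b x. (p, b) \<in> params d \<longrightarrow> x \<in> {1..d} \<longrightarrow> 0 \<le> b x \<longrightarrow> K \<le> real m * p x \<longrightarrow>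
    b x * sqrt (real m * p x) * expect m d p b (\<lambda>z. of_bool (vote m z x \<le> 0)) \<le> C + \<epsilon>"
proof (rule ccontr)
  assume neg: "\<not> ?thesis"
  have "\<forall>k::nat. \<exists>m d p b x. (p, b) \<in> params d \<and> x \<in> {1..d} \<and> 0 \<le> b x \<and> real k + 1 \<le> real m * p x \<and>
      C + \<epsilon> < b x * sqrt (real m * p x) * expect m d p b (\<lambda>z. of_bool (vote m z x \<le> 0))"
  proof
    fix k :: nat
    have "0 < real k + 1" by simp
    with neg show "\<exists>m d p b x. (p, b) \<in> params d \<and> x \<in> {1..d} \<and> 0 \<le> b x \<and> real k + 1 \<le> real m * p x \<and>
      C + \<epsilon> < b x * sqrt (real m * p x) * expect m d p b (\<lambda>z. of_bool (vote m z x \<le> 0))"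
      unfolding not_le[symmetric] by blast
  qed
  then obtain m d p b x where par: "\<And>k. (p k, b k) \<in> params (d k)" and x: "\<And>k. x k \<in> {1..d k}"
    and b: "\<And>k. 0 \<le> b k (x k)" and mean: "\<And>k. real k + 1 \<le> real (m k) * p k (x k)"
    and big: "\<And>k. C + \<epsilon> < b k (x k) * sqrt (real (m k) * p k (x k)) *
        expect (m k) (d k) (p k) (b k) (\<lambda>z. of_bool (vote (m k) z (x k) \<le> 0))"
    by metis
  define \<zeta> where "\<zeta> k = b k (x k) * sqrt (real (m k) * p k (x k))" for k
  define E :: "nat \<Rightarrow> real" where "E k = expect (m k) (d k) (p k) (b k) (\<lambda>z. of_bool (vote (m k) z (x k) \<le> 0))" for k
  have big: "C + \<epsilon> < \<zeta> k * E k" for k using big by (simp add: \<zeta>_def E_def)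
  have \<zeta>0: "0 \<le> \<zeta> k" for k using b[of k] params_D(1)[OF par x, of k] by (simp add: \<zeta>_def)
  have \<zeta>_pos: "0 < \<zeta> k" for k
    using big[of k] C(2) \<open>0 < \<epsilon>\<close> \<zeta>0[of k] by (cases "\<zeta> k = 0") auto
  \<comment> \<open>From C + \<epsilon> < 2 / \<zeta> and C \<ge> 0; this is the compactness needed
    below.\<close>
  have \<zeta>_le: "\<zeta> k \<le> 2 / \<epsilon>" for k
  proof -
    have "\<zeta> k * E k \<le> 2 / \<zeta> k"
      unfolding \<zeta>_def E_def by (rule scaled_lower_tail_le[OF par x b]) (use \<zeta>_pos[of k] in \<open>simp add: \<zeta>_def\<close>)
    with big[of k] C(2) have "\<epsilon> < 2 / \<zeta> k" by linarith
    then show ?thesis using \<zeta>_pos[of k] \<open>0 < \<epsilon>\<close> by (simp add: field_simps)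
  qed
  have "compact {0..2 / \<epsilon>}" by simp
  then obtain l r where l: "l \<in> {0..2 / \<epsilon>}" and r: "strict_mono r" "(\<zeta> \<circ> r) \<longlonglongrightarrow> l"
    using \<zeta>0 \<zeta>_le unfolding compact_eq_seq_compact_metric seq_compact_def by (metis atLeastAtMost_iff)
  have "filterlim (\<lambda>k. real k + 1) at_top sequentially" by real_asymp
  then have "filterlim (\<lambda>k. real (m k) * p k (x k)) at_top sequentially"
    by (rule filterlim_at_top_mono) (use mean in auto)
  then have "filterlim (\<lambda>k. real (m (r k)) * p (r k) (x (r k))) at_top sequentially"
    by (rule filterlim_compose) (rule filterlim_subseq[OF r(1)])
  moreover have "(\<lambda>k. b (r k) (x (r k)) * sqrt (real (m (r k)) * p (r k) (x (r k)))) \<longlonglongrightarrow> l"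
    using r(2) by (simp add: \<zeta>_def comp_def)
  ultimately have "(\<lambda>k. E (r k)) \<longlonglongrightarrow> cdf std_normal_distribution (- l)"
    unfolding E_def by (rule CLT_vote[rotated 2]) (use par x in auto)
  with r(2) have "(\<lambda>k. \<zeta> (r k) * E (r k)) \<longlonglongrightarrow> c_infty_fun l"
    unfolding c_infty_fun_eq comp_def by (rule tendsto_mult)
  moreover have "\<exists>N. \<forall>k\<ge>N. C + \<epsilon> \<le> \<zeta> (r k) * E (r k)" using big less_imp_le by blast
  ultimately have "C + \<epsilon> \<le> c_infty_fun l" by (rule LIMSEQ_le_const)
  with c_infty_fun_limit_le[OF C, of l] l \<open>0 < \<epsilon>\<close> show False by simp
qed

text \<open>Cauchy-Schwarz, by expanding the square of sqrt(d p x) - 1 at each point; equality holds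
  for uniform p.\<close>

lemma sum_sqrt_le:
  fixes p :: "nat \<Rightarrow> real"
  assumes "\<And>x. x \<in> {1..d} \<Longrightarrow> 0 \<le> p x" "(\<Sum>x=1..d. p x) = 1" "d \<ge> 1"
  shows "(\<Sum>x=1..d. sqrt (p x)) \<le> sqrt (real d)"
proof -
  have d: "0 < sqrt (real d)" using assms(3) by simp
  have "(\<Sum>x=1..d. sqrt (p x)) \<le> (\<Sum>x=1..d. (real d * p x + 1) / (2 * sqrt (real d)))"
  proof (rule sum_mono)
    fix x assume "x \<in> {1..d}"
    then have "0 \<le> p x" by (rule assms(1))
    then have "(sqrt (real d) * sqrt (p x) - 1)\<^sup>2 = real d * p x + 1 - 2 * sqrt (real d) * sqrt (p x)"
      by (simp add: power2_eq_square algebra_simps)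
    then have "2 * sqrt (real d) * sqrt (p x) \<le> real d * p x + 1"
      using zero_le_power2[of "sqrt (real d) * sqrt (p x) - 1"] by linarith
    then show "sqrt (p x) \<le> (real d * p x + 1) / (2 * sqrt (real d))" using d by (simp add: field_simps)
  qed
  also have "\<dots> = (real d * (\<Sum>x=1..d. p x) + real d) / (2 * sqrt (real d))"
    unfolding sum_divide_distrib[symmetric] sum.distrib sum_distrib_left[symmetric] by simp
  also have "\<dots> = sqrt (real d)" using d unfolding assms(2) by (simp add: field_simps)
  finally show ?thesis .
qed

text \<open>Points with \<open>real m * p x < K\<close> cost at most \<open>p x\<close>, hence K/m
  each; this total K d/m is of lower order. K is chosen from \<epsilon> and C before m, d and L, so
  the bound is uniform.\<close>

lemma worst_ERM_asymptotic_bound: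
  assumes C: "\<And>y. 0 < y \<Longrightarrow> c_infty_fun y \<le> C" "0 \<le> C" and "0 < \<epsilon>"
  shows "\<exists>K. \<forall>m d L. m \<ge> 1 \<longrightarrow> d \<ge> 1 \<longrightarrow> is_ERM m d L \<longrightarrow>
    worst_risk m d L \<le> K * (real d / real m) + (C + \<epsilon>) * sqrt (real d / real m)"
proof -
  obtain K where K: "0 < K" "\<And>m d p b x. (p, b) \<in> params d \<Longrightarrow> x \<in> {1..d} \<Longrightarrow> 0 \<le> b x \<Longrightarrow> K \<le> real m * p x \<Longrightarrow>
    b x * sqrt (real m * p x) * expect m d p b (\<lambda>z. of_bool (vote m z x \<le> 0)) \<le> C + \<epsilon>"
    using uniform_tail_bound[OF assms] by blast
  show ?thesis
  proof (intro exI allI impI)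
    fix m d :: nat and L assume m: "m \<ge> 1" and d: "d \<ge> 1" and L: "is_ERM m d L"
    show "worst_risk m d L \<le> K * (real d / real m) + (C + \<epsilon>) * sqrt (real d / real m)"
      unfolding worst_risk_def
    proof (rule cSUP_least[OF distributions_nonempty[OF d]])
      fix D assume "D \<in> distributions d"
      then obtain p b' where D: "(p, b') \<in> params d" "D = param_dist d p b'" by (rule distributions_cases)
      define b where "b x = \<bar>b' x\<bar>" for x
      have par: "(p, b) \<in> params d" unfolding b_def by (rule params_abs[OF D(1)])
      define E :: "nat \<Rightarrow> real" where "E x = expect m d p b (\<lambda>z. of_bool (vote m z x \<le> 0))" for x
      have E: "0 \<le> E x" "E x \<le> 1" for x
        using expect_mono[OF par, of m "\<lambda>_. 0" "\<lambda>z. of_bool (vote m z x \<le> 0)"]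
          expect_mono[OF par, of m "\<lambda>z. of_bool (vote m z x \<le> 0)" "\<lambda>_. 1"]
        by (simp_all add: expect_const[OF par] E_def)
      have bound: "p x * b x * E x \<le> K / real m + (C + \<epsilon>) * (sqrt (p x) / sqrt (real m))" if x: "x \<in> {1..d}" for x
      proof (cases "K \<le> real m * p x")
        case True
        have px: "0 < p x" using True K(1) m by (smt (verit) mult_nonneg_nonpos of_nat_0_le_iff)
        then have sp: "0 < sqrt (p x)" "0 < sqrt (real m)" using m by auto
        have "b x * sqrt (real m * p x) * E x \<le> C + \<epsilon>"
          unfolding E_def by (rule K(2)[OF par x _ True]) (simp add: b_def)
        then have "(b x * sqrt (real m * p x) * E x) * (sqrt (p x) / sqrt (real m)) \<le> (C + \<epsilon>) * (sqrt (p x) / sqrt (real m))"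
          using sp by (intro mult_right_mono) auto
        also have "(b x * sqrt (real m * p x) * E x) * (sqrt (p x) / sqrt (real m)) = p x * b x * E x"
          using sp px by (simp add: real_sqrt_mult)
        moreover have "0 \<le> K / real m" using K(1) by simp
        ultimately show ?thesis by linarith
      next
        case False
        have "b x * E x \<le> 1" using params_D(3)[OF par x] E[of x] by (intro mult_le_one) (auto simp: b_def)
        then have "p x * (b x * E x) \<le> p x * 1" using params_D(1)[OF par x] by (intro mult_left_mono)
        also have "p x * 1 \<le> K / real m" using False m by (simp add: field_simps)
        finally have "p x * b x * E x \<le> K / real m" by (simp add: mult.assoc)
        moreover have "0 \<le> (C + \<epsilon>) * (sqrt (p x) / sqrt (real m))"
          using C(2) \<open>0 < \<epsilon>\<close> params_D(1)[OF par x] by simp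
        ultimately show ?thesis by linarith
      qed
      have "risk m d L D \<le> (\<Sum>x=1..d. p x * b x * E x)"
        using ERM_risk_le[OF L D(1)] unfolding D(2) b_def E_def .
      also have "\<dots> \<le> (\<Sum>x=1..d. K / real m + (C + \<epsilon>) * (sqrt (p x) / sqrt (real m)))"
        by (rule sum_mono) (rule bound)
      also have "\<dots> = K * (real d / real m) + (C + \<epsilon>) * ((\<Sum>x=1..d. sqrt (p x)) / sqrt (real m))"
        by (simp add: sum.distrib sum_distrib_left sum_divide_distrib)
      also have "\<dots> \<le> K * (real d / real m) + (C + \<epsilon>) * (sqrt (real d) / sqrt (real m))"
        using C(2) \<open>0 < \<epsilon>\<close> params_D(1,4)[OF par] d
        by (intro add_left_mono mult_left_mono divide_right_mono sum_sqrt_le) auto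
      finally show "risk m d L D \<le> K * (real d / real m) + (C + \<epsilon>) * sqrt (real d / real m)"
        by (simp add: real_sqrt_divide)
    qed
  qed
qed

text \<open>Tests the lower bound at uniform p with a constant bias whose drift is z. Replacing the
  fair loss by the indicator of a nonpositive vote costs half a tie, which is negligible by
  \<open>tie_term_le\<close>.\<close>

lemma minimax_rand_asymptotic_bound:
  fixes m d :: "nat \<Rightarrow> nat"
  assumes d: "\<And>k. d k \<ge> 1" and top: "filterlim (\<lambda>k. real (m k) / real (d k)) at_top sequentially"
    and z: "0 < z"
  shows "\<exists>a. a \<longlonglongrightarrow> c_infty_fun z \<and>
    (\<forall>\<^sub>F k in sequentially. a k \<le> minimax_rand_risk (m k) (d k) * sqrt (real (m k) / real (d k)))"
proof -
  define \<rho> where "\<rho> k = real (m k) / real (d k)" for k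
  define p where "p k = (\<lambda>_::nat. 1 / real (d k))" for k
  \<comment> \<open>The cap keeps the bias admissible for every k; for large m/d the minimum is the
    second argument.\<close>
  define \<beta> where "\<beta> k = min 1 (z / sqrt (\<rho> k))" for k
  define b where "b k = (\<lambda>_::nat. \<beta> k)" for k
  have \<rho>_top: "filterlim \<rho> at_top sequentially" using top by (simp add: \<rho>_def[abs_def])
  have \<rho>0: "0 \<le> \<rho> k" for k by (simp add: \<rho>_def)
  have \<beta>: "0 \<le> \<beta> k" "\<beta> k \<le> 1" for k using z \<rho>0[of k] by (auto simp: \<beta>_def)
  have par: "(p k, b k) \<in> params (d k)" for k
    using d[of k] \<beta>[of k] by (auto simp: params_def p_def b_def)
  define G where "G k x = expect (m k) (d k) (p k) (b k) (\<lambda>z. vote_loss (vote (m k) z x))" for k x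
  \<comment> \<open>The limit theorem follows one point per k, while the lower bound averages over
    all points. Taking the point with the least loss bounds the average from below without comparing
    the points.\<close>
  define x where "x k = arg_min_on (G k) {1..d k}" for k
  have x: "x k \<in> {1..d k}" "\<And>y. y \<in> {1..d k} \<Longrightarrow> G k (x k) \<le> G k y" for k
    using arg_min_if_finite(1)[of "{1..d k}" "G k"] arg_min_least[of "{1..d k}" _ "G k"] d[of k]
    unfolding x_def by auto
  define P :: "nat \<Rightarrow> real" where "P k = expect (m k) (d k) (p k) (b k) (\<lambda>z. of_bool (vote (m k) z (x k) \<le> 0))" for k
  define T :: "nat \<Rightarrow> real" where "T k = expect (m k) (d k) (p k) (b k) (\<lambda>z. of_bool (vote (m k) z (x k) = 0))" for k
  have large: "\<forall>\<^sub>F k in sequentially. \<rho> k > max 1 (z\<^sup>2)" using \<rho>_top unfolding filterlim_at_top_dense by blast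
  have ev: "\<forall>\<^sub>F k in sequentially. \<rho> k > 1 \<and> \<beta> k * sqrt (\<rho> k) = z"
    using large
  proof eventually_elim
    case (elim k)
    then have "z \<le> sqrt (\<rho> k)" by (intro real_le_rsqrt) simp
    with elim z show ?case by (auto simp: \<beta>_def min_def field_simps)
  qed
  have mean_eq: "real (m k) * p k (x k) = \<rho> k" for k by (simp add: p_def \<rho>_def)
  have P_lim: "P \<longlonglongrightarrow> cdf std_normal_distribution (- z)"
    unfolding P_def
  proof (rule CLT_vote[OF par x(1)])
    show "filterlim (\<lambda>k. real (m k) * p k (x k)) at_top sequentially" unfolding mean_eq by (rule \<rho>_top)
    have "\<forall>\<^sub>F k in sequentially. z = b k (x k) * sqrt (real (m k) * p k (x k))"
      using ev by eventually_elim (simp only: mean_eq b_def)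
    from Lim_transform_eventually[OF tendsto_const this]
    show "(\<lambda>k. b k (x k) * sqrt (real (m k) * p k (x k))) \<longlonglongrightarrow> z" .
  qed
  \<comment> \<open>The subtracted term is half the bound 1/\<rho> on the tie contribution,
    multiplied by sqrt \<rho>.\<close>
  define a where "a k = z * P k - 1 / (2 * sqrt (\<rho> k))" for k
  have "((\<lambda>r. 1 / (2 * sqrt r)) \<longlongrightarrow> 0) at_top" by real_asymp
  from filterlim_compose[OF this \<rho>_top] have "(\<lambda>k. 1 / (2 * sqrt (\<rho> k))) \<longlonglongrightarrow> 0" .
  from tendsto_diff[OF tendsto_mult[OF tendsto_const P_lim] this]
  have a_lim: "a \<longlonglongrightarrow> c_infty_fun z" unfolding a_def[abs_def] c_infty_fun_eq by simp
  have "\<forall>\<^sub>F k in sequentially. a k \<le> minimax_rand_risk (m k) (d k) * sqrt (\<rho> k)"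
    using ev
  proof eventually_elim
    case (elim k)
    have dk: "real (d k) > 0" using d[of k] by simp
    have sr: "0 < sqrt (\<rho> k)" using elim by simp
    have "p k (x k) * \<bar>b k (x k)\<bar> * T k \<le> 1 / (real (m k) + 1)"
      unfolding T_def by (rule tie_term_le[OF par x(1)])
    then have "\<beta> k * T k \<le> real (d k) / (real (m k) + 1)"
      using dk \<beta>[of k] by (simp add: p_def b_def field_simps)
    also have "\<dots> \<le> 1 / \<rho> k"
      using dk elim by (simp add: \<rho>_def field_simps)
    finally have tie: "\<beta> k * T k \<le> 1 / \<rho> k" .
    have "\<beta> k * G k (x k) = (\<Sum>y=1..d k. p k y * \<bar>b k y\<bar> * G k (x k))"
      using dk \<beta>[of k] by (simp add: p_def b_def)
    also have "\<dots> \<le> (\<Sum>y=1..d k. p k y * \<bar>b k y\<bar> * G k y)"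
      by (intro sum_mono mult_left_mono x(2)) (auto simp: p_def)
    also have "\<dots> \<le> minimax_rand_risk (m k) (d k)"
      using minimax_rand_lower[OF par, of k "m k"] \<beta>[of k] by (simp add: G_def b_def)
    finally have "\<beta> k * G k (x k) \<le> minimax_rand_risk (m k) (d k)" .
    moreover have "P k = G k (x k) + 1 / 2 * T k"
      unfolding P_def G_def T_def expect_cmult[symmetric] expect_add[symmetric] of_bool_nonpos_eq_vote_loss by simp
    ultimately have "\<beta> k * P k - 1 / 2 * (\<beta> k * T k) \<le> minimax_rand_risk (m k) (d k)"
      by (simp add: algebra_simps)
    with tie have "\<beta> k * P k - 1 / 2 * (1 / \<rho> k) \<le> minimax_rand_risk (m k) (d k)" by linarith
    then have "(\<beta> k * P k - 1 / 2 * (1 / \<rho> k)) * sqrt (\<rho> k) \<le> minimax_rand_risk (m k) (d k) * sqrt (\<rho> k)"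
      using sr by (intro mult_right_mono) auto
    moreover have "(\<beta> k * P k - 1 / 2 * (1 / \<rho> k)) * sqrt (\<rho> k) = a k"
    proof -
      have 1: "1 / \<rho> k * sqrt (\<rho> k) = 1 / sqrt (\<rho> k)"
        using sr \<rho>0[of k] by (simp add: field_simps)
      have 2: "\<beta> k * P k * sqrt (\<rho> k) = z * P k" using elim by (metis mult.assoc mult.commute)
      have "(\<beta> k * P k - 1 / 2 * (1 / \<rho> k)) * sqrt (\<rho> k)
        = \<beta> k * P k * sqrt (\<rho> k) - 1 / 2 * (1 / \<rho> k * sqrt (\<rho> k))"
        by (simp add: left_diff_distrib)
      also have "\<dots> = z * P k - 1 / 2 * (1 / sqrt (\<rho> k))" by (simp only: 1 2)
      finally show ?thesis by (simp add: a_def)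
    qed
    ultimately show ?case by simp
  qed
  with a_lim show ?thesis unfolding \<rho>_def by blast
qed

section \<open>From the bounds to the asymptotic relations\<close>

lemma ERM_in_learners: "is_ERM m d L \<Longrightarrow> L \<in> learners m d"
  by (simp add: is_ERM_def)

lemma tie_bound_nonneg: "d \<ge> 1 \<Longrightarrow> 0 \<le> tie_bound m d"
proof -
  assume "d \<ge> 1"
  then obtain p b where par: "(p, b) \<in> params d" using params_nonempty by fast
  show "0 \<le> tie_bound m d" using tie_bound_ge[OF par, of m] tie_sum_bounds(1)[OF par, of m] by linarith
qed

text \<open>The equation between the O and o terms is read as an inclusion of classes.\<close>

lemma bigo_inverse_subset_smallo:
  fixes \<rho> :: "nat \<Rightarrow> real"
  assumes "filterlim \<rho> at_top sequentially"
  shows "O[sequentially](\<lambda>k. 1 / \<rho> k) \<subseteq> o[sequentially](\<lambda>k. 1 / sqrt (\<rho> k))"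
proof
  have "(\<lambda>r::real. 1 / r) \<in> o[at_top](\<lambda>r. 1 / sqrt r)" by real_asymp
  from landau_o.small.compose[OF this assms]
  have "(\<lambda>k. 1 / \<rho> k) \<in> o[sequentially](\<lambda>k. 1 / sqrt (\<rho> k))" .
  then show "f \<in> o[sequentially](\<lambda>k. 1 / sqrt (\<rho> k))" if "f \<in> O[sequentially](\<lambda>k. 1 / \<rho> k)" for f
    using that by (rule landau_o.big_small_trans[rotated])
qed

text \<open>One lower bound, for the randomized minimax risk, and one upper bound, for the empirical
  risk minimizer, squeeze both sequences because the former risk never exceeds the latter.\<close>

lemma scaled_risks_tendsto:
  fixes m d :: "nat \<Rightarrow> nat"
  assumes d: "\<And>k. d k \<ge> 1" and top: "filterlim (\<lambda>k. real (m k) / real (d k)) at_top sequentially"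
    and L: "\<And>k. is_ERM (m k) (d k) (L k)"
  shows "(\<lambda>k. minimax_rand_risk (m k) (d k) * sqrt (real (m k) / real (d k))) \<longlonglongrightarrow> c_infty"
    and "(\<lambda>k. worst_risk (m k) (d k) (L k) * sqrt (real (m k) / real (d k))) \<longlonglongrightarrow> c_infty"
proof -
  define \<rho> where "\<rho> k = real (m k) / real (d k)" for k
  let ?lo = "\<lambda>k. minimax_rand_risk (m k) (d k) * sqrt (\<rho> k)"
  let ?up = "\<lambda>k. worst_risk (m k) (d k) (L k) * sqrt (\<rho> k)"
  have \<rho>_top: "filterlim \<rho> at_top sequentially" using top by (simp add: \<rho>_def[abs_def])
  obtain z where z: "0 < z" "c_infty_fun z = c_infty" "\<And>y. 0 < y \<Longrightarrow> c_infty_fun y \<le> c_infty"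
    using c_infty_attained by blast
  have c0: "0 \<le> c_infty" using c_infty_bounds(1) by simp
  obtain a where a: "a \<longlonglongrightarrow> c_infty" "\<forall>\<^sub>F k in sequentially. a k \<le> ?lo k"
    using minimax_rand_asymptotic_bound[OF d top z(1)] unfolding z(2) \<rho>_def by blast
  have le: "?lo k \<le> ?up k" for k
    using minimax_rand_le_minimax[OF d, of "m k" k] minimax_le_worst[OF d ERM_in_learners[OF L], of k]
    by (intro mult_right_mono) (auto simp: \<rho>_def)
  have upper: "\<forall>\<^sub>F k in sequentially. ?up k < c_infty + \<epsilon>" if eps: "0 < \<epsilon>" for \<epsilon>
  proof -
    obtain K where K: "\<And>m d L. m \<ge> 1 \<Longrightarrow> d \<ge> 1 \<Longrightarrow> is_ERM m d L \<Longrightarrow>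
        worst_risk m d L \<le> K * (real d / real m) + (c_infty + \<epsilon> / 2) * sqrt (real d / real m)"
      using worst_ERM_asymptotic_bound[OF z(3) c0 half_gt_zero[OF eps]] by blast
    have "((\<lambda>r. K / sqrt r) \<longlongrightarrow> 0) at_top" by real_asymp
    from filterlim_compose[OF this \<rho>_top] have "\<forall>\<^sub>F k in sequentially. K / sqrt (\<rho> k) < \<epsilon> / 2"
      using eps by (intro order_tendstoD(2)[of _ 0]) auto
    moreover have "\<forall>\<^sub>F k in sequentially. \<rho> k > 0" using \<rho>_top unfolding filterlim_at_top_dense by blast
    ultimately show ?thesis
    proof eventually_elim
      case (elim k)
      have m: "m k \<ge> 1" using elim(2) by (cases "m k") (auto simp: \<rho>_def)
      have inv: "real (d k) / real (m k) = 1 / \<rho> k" by (simp add: \<rho>_def)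
      have sr: "0 < sqrt (\<rho> k)" using elim(2) by simp
      have "?up k \<le> (K * (1 / \<rho> k) + (c_infty + \<epsilon> / 2) * sqrt (1 / \<rho> k)) * sqrt (\<rho> k)"
        using K[OF m d L] sr unfolding inv by (intro mult_right_mono) auto
      also have "\<dots> = K * (1 / \<rho> k * sqrt (\<rho> k)) + (c_infty + \<epsilon> / 2) * (sqrt (1 / \<rho> k) * sqrt (\<rho> k))"
        by (simp only: distrib_right mult.assoc)
      also have "1 / \<rho> k * sqrt (\<rho> k) = 1 / sqrt (\<rho> k)" using elim(2) by (simp add: field_simps)
      also have "sqrt (1 / \<rho> k) * sqrt (\<rho> k) = 1" using elim(2) by (simp add: real_sqrt_divide)
      finally have "?up k \<le> K / sqrt (\<rho> k) + (c_infty + \<epsilon> / 2)" by simp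
      with elim(1) show ?case by linarith
    qed
  qed
  have "?up \<longlonglongrightarrow> c_infty"
  proof (rule order_tendstoI)
    fix y assume "y < c_infty"
    from order_tendstoD(1)[OF a(1) this] a(2)
    show "\<forall>\<^sub>F k in sequentially. y < ?up k"
      by eventually_elim (use le in \<open>meson less_le_trans order_trans\<close>)
  next
    fix y assume "c_infty < y"
    then show "\<forall>\<^sub>F k in sequentially. ?up k < y" using upper[of "y - c_infty"] by simp
  qed
  then show "(\<lambda>k. worst_risk (m k) (d k) (L k) * sqrt (real (m k) / real (d k))) \<longlonglongrightarrow> c_infty"
    by (simp add: \<rho>_def)
  have "?lo \<longlonglongrightarrow> c_infty"
    by (rule tendsto_sandwich[OF a(2) _ a(1) \<open>?up \<longlonglongrightarrow> c_infty\<close>]) (use le in auto)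
  then show "(\<lambda>k. minimax_rand_risk (m k) (d k) * sqrt (real (m k) / real (d k))) \<longlonglongrightarrow> c_infty"
    by (simp add: \<rho>_def)
qed

lemma asymp_equiv_div_sqrt:
  fixes f \<rho> :: "nat \<Rightarrow> real"
  assumes "(\<lambda>k. f k * sqrt (\<rho> k)) \<longlonglongrightarrow> c" "c \<noteq> 0"
  shows "f \<sim>[sequentially] (\<lambda>k. c / sqrt (\<rho> k))"
proof (rule asymp_equivI')
  have "(\<lambda>k. f k * sqrt (\<rho> k) / c) \<longlonglongrightarrow> c / c" by (intro tendsto_divide assms tendsto_const)
  then show "(\<lambda>k. f k / (c / sqrt (\<rho> k))) \<longlonglongrightarrow> 1" using assms(2) by simp
qed

theorem theorem2p4:
  fixes L_ERM :: "nat \<Rightarrow> nat \<Rightarrow> sample \<Rightarrow> nat \<Rightarrow> int"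
  assumes erm: "\<And>m d. d \<ge> 1 \<Longrightarrow> is_ERM m d (L_ERM m d)"
  shows
    "(\<exists>z>0. c_infty_fun z = c_infty) \<and> (\<forall>z>0. c_infty_fun z \<le> c_infty) \<and>
     0.16997 \<le> c_infty \<and> c_infty < 0.16998 \<and>
     (\<forall>m d. d \<ge> 1 \<longrightarrow>
        minimax_rand_risk m d \<le> minimax_risk m d \<and>
        minimax_risk m d \<le> worst_risk m d (L_ERM m d) \<and>
        0 \<le> worst_risk m d (L_ERM m d) - minimax_rand_risk m d \<and>
        worst_risk m d (L_ERM m d) - minimax_rand_risk m d \<le> tie_bound m d) \<and>
     (\<forall>m d :: nat \<Rightarrow> nat.
        (\<forall>k. d k \<ge> 1) \<and> filterlim (\<lambda>k. real (m k) / real (d k)) at_top sequentially \<longrightarrow>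
        (\<lambda>k. minimax_rand_risk (m k) (d k))
          \<sim>[sequentially] (\<lambda>k. c_infty / sqrt (real (m k) / real (d k))) \<and>
        (\<lambda>k. worst_risk (m k) (d k) (L_ERM (m k) (d k)))
          \<sim>[sequentially] (\<lambda>k. c_infty / sqrt (real (m k) / real (d k))) \<and>
        (\<lambda>k. tie_bound (m k) (d k)) \<in> O[sequentially](\<lambda>k. 1 / (real (m k) / real (d k))) \<and>
        O[sequentially](\<lambda>k. 1 / (real (m k) / real (d k)))
          \<subseteq> o[sequentially](\<lambda>k. 1 / sqrt (real (m k) / real (d k))))"
proof (intro conjI allI impI; (elim conjE)?)
  show "\<exists>z>0. c_infty_fun z = c_infty" using c_infty_attained by blast
  show "c_infty_fun z \<le> c_infty" if "0 < z" for z using c_infty_attained that by blast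
  show "0.16997 \<le> c_infty" "c_infty < 0.16998" by (rule c_infty_bounds)+
next
  fix m d :: nat assume d: "d \<ge> 1"
  show 1: "minimax_rand_risk m d \<le> minimax_risk m d" by (rule minimax_rand_le_minimax[OF d])
  show 2: "minimax_risk m d \<le> worst_risk m d (L_ERM m d)"
    by (rule minimax_le_worst[OF d ERM_in_learners[OF erm[OF d]]])
  from 1 2 show "0 \<le> worst_risk m d (L_ERM m d) - minimax_rand_risk m d" by simp
  show "worst_risk m d (L_ERM m d) - minimax_rand_risk m d \<le> tie_bound m d"
    using worst_ERM_le[OF d erm[OF d], of m] by simp
next
  fix m d :: "nat \<Rightarrow> nat"
  assume "\<forall>k. d k \<ge> 1" and top: "filterlim (\<lambda>k. real (m k) / real (d k)) at_top sequentially"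
  then have d: "\<And>k. d k \<ge> 1" by simp
  have c: "c_infty \<noteq> 0" using c_infty_bounds(1) by auto
  note lims = scaled_risks_tendsto[OF d top erm[OF d]]
  show "(\<lambda>k. minimax_rand_risk (m k) (d k)) \<sim>[sequentially] (\<lambda>k. c_infty / sqrt (real (m k) / real (d k)))"
    by (rule asymp_equiv_div_sqrt[OF lims(1) c])
  show "(\<lambda>k. worst_risk (m k) (d k) (L_ERM (m k) (d k)))
      \<sim>[sequentially] (\<lambda>k. c_infty / sqrt (real (m k) / real (d k)))"
    by (rule asymp_equiv_div_sqrt[OF lims(2) c])
  show "(\<lambda>k. tie_bound (m k) (d k)) \<in> O[sequentially](\<lambda>k. 1 / (real (m k) / real (d k)))"
  proof (rule bigoI[where c = 1])
    have "\<forall>\<^sub>F k in sequentially. real (m k) / real (d k) > 0"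
      using top unfolding filterlim_at_top_dense by blast
    then show "\<forall>\<^sub>F k in sequentially. norm (tie_bound (m k) (d k)) \<le> 1 * norm (1 / (real (m k) / real (d k)))"
    proof eventually_elim
      case (elim k)
      then have m: "0 < real (m k)" by (auto simp: zero_less_divide_iff)
      have "tie_bound (m k) (d k) \<le> real (d k) / (2 * (real (m k) + 1))" by (rule tie_bound_le[OF d])
      also have "\<dots> \<le> real (d k) / real (m k)" using m by (intro divide_left_mono) auto
      finally show ?case using tie_bound_nonneg[OF d, of "m k" k] by simp
    qed
  qed
  show "O[sequentially](\<lambda>k. 1 / (real (m k) / real (d k)))
      \<subseteq> o[sequentially](\<lambda>k. 1 / sqrt (real (m k) / real (d k)))"
    by (rule bigo_inverse_subset_smallo[OF top])
qed

end
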